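(* Let $\bar c$, $H'$, $P$, $\Delta$ be as described below and let $\bar\xi$ be a vertex of $\Delta$ of type (2), i.e. $J(\bar c,\bar\xi)\ne0$ and $c=2\bar c-d$, $\xi=2\bar\xi-d$ are collinear with an edge $vw$ of $\operatorname{conv}(\mathcal W)$, labelled so that $v$ is the endpoint nearer to $c$. Suppose there are no points of $\mathcal W$ in the interior of $vw$. Then either (i) $c=2v-w$, and the points of $\mathcal C$ on the line through $\bar c,\bar\xi$ are exactly $\bar c$ and $\bar w$; or (ii) $c=\frac13(4v-w)$, the points of $\mathcal C$ on this line are exactly $\bar c$, $\bar w$ and $\bar c^{(1)}=\frac13(2\bar v+\bar w)=\frac12(\bar c+\bar w)$, and $J(\bar c^{(1)},\bar w)=0$.
   Context: Setting: $G$ compact Lie group, $K\subset G$ closed, $G/K$ connected almost effective, isotropy representation $\mathfrak p=\mathfrak p_1\oplus\cdots\oplus\mathfrak p_r$ ($r\ge2$) with pairwise inequivalent $\mathbb R$-irreducible summands, $d_i=\dim\mathfrak p_i$, $d=(d_1,\dots,d_r)$, $n=\sum d_i$. The scalar curvature of the metric $e^{q_i}Q$ on $\mathfrak p_i$ is $S(q)=\sum_{w\in\mathcal W}A_we^{w\cdot q}$, $\mathcal W\subset\mathbb Z^r$ finite, $A_w\ne0$, each $w$ of type I (one entry $-1$), type II (one entry $1$, two entries $-1$) or type III (one entry $1$, one entry $-2$), other entries $0$; $A_w>0$ for type I and $<0$ otherwise. Assume $\dim\operatorname{conv}(\mathcal W)=r-1$. $J$ is the symmetric bilinear form with $J(p,p)=\frac1{n-1}(\sum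 p_i)^2-\sum p_i^2/d_i$; null means $J(\bar x,\bar x)=0$. $u=\sum_{\bar c\in\mathcal C}F_{\bar c}e^{\bar c\cdot q}$ ($\mathcal C$ finite, $F_{\bar c}\ne0$) is a superpotential: for every $\xi$, $\sum_{(\bar a,\bar c)\in\mathcal C^2,\ \bar a+\bar c=\xi}J(\bar a,\bar c)F_{\bar a}F_{\bar c}$ equals $A_w$ if $\xi=d+w$, $w\in\mathcal W$, and $0$ otherwise; $\mathcal C$ is normalised to lie in $\mathcal H=\{\sum\bar x_i=\frac12(n-1)\}$. For $x$ with $\sum x_i=-1$ write $\bar x=\frac12(d+x)$. $\bar c\in\mathcal C$ is a null vertex of $\operatorname{conv}(\mathcal C)$ (it lies outside $\operatorname{conv}(\frac12(d+\mathcal W))$), $H'\subset\mathcal H$ is an affine hyperplane strictly separating $\bar c$ from $\operatorname{conv}(\frac12(d+\mathcal W))$, $P$ sends $\bar z\in\operatorname{conv}(\frac12(d+\mathcal W))$ to the intersection of the ray from $\bar c$ through $\bar z$ with $H'$, and $\Delta$ is the image of $P$. *)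

theory Defs
  imports "HOL-Analysis.Analysis"
begin

definition csum :: "real^'r::finite \<Rightarrow> real" where
  "csum x = (\<Sum>i\<in>UNIV. x $ i)"

definition dvec :: "('r::finite \<Rightarrow> nat) \<Rightarrow> real^'r" where
  "dvec d = (\<chi> i. real (d i))"

definition ndim :: "('r::finite \<Rightarrow> nat) \<Rightarrow> nat" where
  "ndim d = (\<Sum>i\<in>UNIV. d i)"

definition Jf :: "('r::finite \<Rightarrow> nat) \<Rightarrow> real^'r \<Rightarrow> real^'r \<Rightarrow> real" where
  "Jf d p q = csum p * csum q / (real (ndim d) - 1) - (\<Sum>i\<in>UNIV. p $ i * q $ i / real (d i))"

definition bar :: "('r::finite \<Rightarrow> nat) \<Rightarrow> real^'r \<Rightarrow> real^'r" where
  "bar d x = (1/2::real) *\<^sub>R (dvec d + x)"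

definition typeI :: "real^'r::finite \<Rightarrow> bool" where
  "typeI w \<longleftrightarrow> (\<exists>i. w = - axis i 1)"

definition typeII :: "real^'r::finite \<Rightarrow> bool" where
  "typeII w \<longleftrightarrow> (\<exists>i j k. i \<noteq> j \<and> i \<noteq> k \<and> j \<noteq> k \<and> w = axis i 1 - axis j 1 - axis k 1)"

definition typeIII :: "real^'r::finite \<Rightarrow> bool" where
  "typeIII w \<longleftrightarrow> (\<exists>i j. i \<noteq> j \<and> w = axis i 1 - 2 *\<^sub>R axis j 1)"

text \<open>u = sum of F_c e^{c.q} over C is a superpotential for S = sum of A_w e^{w.q} over W.\<close>
definition is_superpotential ::
  "('r::finite \<Rightarrow> nat) \<Rightarrow> (real^'r) set \<Rightarrow> (real^'r \<Rightarrow> real) \<Rightarrow> (real^'r) set \<Rightarrow> (real^'r \<Rightarrow> real) \<Rightarrow> bool" where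
  "is_superpotential d W A C F \<longleftrightarrow> finite C \<and> (\<forall>c\<in>C. F c \<noteq> 0) \<and>
     (\<forall>\<xi>. (\<Sum>p\<in>{p. fst p \<in> C \<and> snd p \<in> C \<and> fst p + snd p = \<xi>}. Jf d (fst p) (snd p) * F (fst p) * F (snd p))
          = (if \<xi> - dvec d \<in> W then A (\<xi> - dvec d) else 0))"

text \<open>The central projection P from cb onto the hyperplane H' = {x \<in> H. a \<bullet> x = b}.\<close>
definition projP :: "real^'r::finite \<Rightarrow> real^'r \<Rightarrow> real \<Rightarrow> real^'r \<Rightarrow> real^'r" where
  "projP cb a b z = cb + ((b - a \<bullet> cb) / (a \<bullet> (z - cb))) *\<^sub>R (z - cb)"

end

theory Submission
  imports Defs
begin

text \<open>
  Let \<open>\<eta>\<close> be the direction of an edge of \<open>conv C\<close> at the null vertex \<open>cb\<close>. The sum of \<open>cb\<close> and the nearest point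
  of \<open>C\<close> on the edge, and twice the far end of the edge, arise in only one way as sums of two points of \<open>C\<close>; since
  \<open>J\<close> is negative definite on vectors with vanishing coordinate sum, one of the two lies in \<open>d + W\<close>. Hence
  \<open>conv C\<close> and \<open>conv (bar d ` W)\<close> span the same cone at \<open>cb\<close>, so the line through \<open>cb\<close> and the vertex
  \<open>xib\<close> cuts out an edge of \<open>conv C\<close>, and the superpotential equation restricts to it.

  On the line, write \<open>cb + t \<delta>\<close> with \<open>\<delta> = v - c\<close>, \<open>c = 2 cb - d\<close>. The restricted equation is a quadratic recursion with
  right-hand sides \<open>A v\<close> at \<open>t = 1\<close> and \<open>A w\<close> at some \<open>t = \<gamma> > 1\<close>. It forces all exponents to be
  natural numbers, and the signs of the coefficients of \<open>u\<close> to depend on the parity of the exponent only; if the largest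
  exponent were \<open>N \<ge> 3\<close>, the terms in degree \<open>N + 1\<close> could not cancel. Besides the two claimed configurations
  there remains one with a second null end, in which \<open>A v\<close> and \<open>A w\<close> have opposite signs. Then exactly one of
  \<open>v\<close>, \<open>w\<close> is of type I, and the two nullity conditions give \<open>5 = 2 d i\<close>.
\<close>

subsection \<open>Quadratic recursions\<close>

text \<open>Only \<open>(s, t)\<close> and \<open>(t, s)\<close> contribute, with equal terms, so
  the sum is \<open>J s t * F s * F t\<close> taken once or twice, according to whether
  \<open>s = t\<close>.\<close>

lemma unique_pair_zero:
  fixes J :: "'a::ab_group_add \<Rightarrow> 'a \<Rightarrow> real"
  assumes sym: "J s t = J t s" and "s \<in> C" "t \<in> C" "F s \<noteq> 0" "F t \<noteq> 0"
    and unique: "\<And>x y. x \<in> C \<Longrightarrow> y \<in> C \<Longrightarrow> x + y = s + t \<Longrightarrow> x = s \<or> x = t"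
    and sum0: "(\<Sum>p\<in>{p. fst p \<in> C \<and> snd p \<in> C \<and> fst p + snd p = s + t}.
                 J (fst p) (snd p) * F (fst p) * F (snd p)) = 0"
  shows "J s t = 0"
proof -
  have "y = t" if "x = s" "x + y = s + t" for x y
    using that by simp
  moreover have "y = s" if "x = t" "x + y = s + t" for x y
    using that by (simp add: add.commute)
  ultimately have pair: "(x, y) = (s, t) \<or> (x, y) = (t, s)" if "x \<in> C" "y \<in> C" "x + y = s + t" for x y
    using unique[OF that] that(3) by blast
  have "{p. fst p \<in> C \<and> snd p \<in> C \<and> fst p + snd p = s + t} = {(s,t), (t,s)}"
  proof (intro equalityI subsetI)
    fix p assume "p \<in> {p. fst p \<in> C \<and> snd p \<in> C \<and> fst p + snd p = s + t}"
    then show "p \<in> {(s,t), (t,s)}" using pair[of "fst p" "snd p"] by auto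
  qed (use assms(2,3) in \<open>auto simp: add.commute\<close>)
  with sum0 sym assms(4,5) show ?thesis
    by (cases "s = t") (auto simp: algebra_simps)
qed

text \<open>Turns the convolution over pairs of real exponents into a Cauchy product, with
  coefficients extended by 0 off \<open>T\<close>, so that induction on the degree becomes
  available.\<close>

lemma sum_pairs_nat:
  fixes J :: "real \<Rightarrow> real \<Rightarrow> real" and T :: "real set" and g :: "real \<Rightarrow> real"
  assumes "finite T" and nat: "\<And>t. t \<in> T \<Longrightarrow> \<exists>n. t = real n"
  defines "p \<equiv> \<lambda>n. if real n \<in> T then g (real n) else 0"
  shows "(\<Sum>q\<in>{q. fst q \<in> T \<and> snd q \<in> T \<and> fst q + snd q = real k}.
            J (fst q) (snd q) * g (fst q) * g (snd q))
       = (\<Sum>i\<le>k. J (real i) (real (k - i)) * p i * p (k - i))"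
proof -
  let ?I = "{i. i \<le> k \<and> real i \<in> T \<and> real (k - i) \<in> T}"
  have bij: "bij_betw (\<lambda>i. (real i, real (k - i))) ?I {q. fst q \<in> T \<and> snd q \<in> T \<and> fst q + snd q = real k}"
    unfolding bij_betw_def
  proof (intro conjI set_eqI iffI)
    show "inj_on (\<lambda>i. (real i, real (k - i))) ?I" by (auto simp: inj_on_def)
  next
    fix q :: "real \<times> real"
    assume q: "q \<in> {q. fst q \<in> T \<and> snd q \<in> T \<and> fst q + snd q = real k}"
    then obtain m n where mn: "fst q = real m" "snd q = real n" using nat by fastforce
    with q have "m + n = k" by (simp flip: of_nat_add)
    with q mn have "m \<in> ?I" "q = (real m, real (k - m))" by (auto simp: prod_eq_iff)
    then show "q \<in> (\<lambda>i. (real i, real (k - i))) ` ?I" by blast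
  qed (auto simp: of_nat_diff)
  have "(\<Sum>i\<le>k. J (real i) (real (k - i)) * p i * p (k - i))
      = (\<Sum>i\<in>?I. J (real i) (real (k - i)) * p i * p (k - i))"
    by (rule sum.mono_neutral_right) (auto simp: p_def)
  also have "\<dots> = (\<Sum>i\<in>?I. J (real i) (real (k - i)) * g (real i) * g (real (k - i)))"
    by (rule sum.cong) (auto simp: p_def)
  also have "\<dots> = (\<Sum>q\<in>{q. fst q \<in> T \<and> snd q \<in> T \<and> fst q + snd q = real k}.
            J (fst q) (snd q) * g (fst q) * g (snd q))"
    using sum.reindex_bij_betw[OF bij, of "\<lambda>q. J (fst q) (snd q) * g (fst q) * g (snd q)"] by simp
  finally show ?thesis by simp
qed

text \<open>By \<open>pat\<close>, \<open>p k\<close> has the sign of \<open>p 1\<close> for odd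
  \<open>k\<close> and of \<open>- p 0\<close> for even \<open>k\<close>. Index 0 is left out
  because \<open>p 0\<close> itself breaks the even rule.\<close>

lemma alternating_product:
  fixes p :: "nat \<Rightarrow> real"
  assumes pat: "\<And>k. 1 \<le> k \<Longrightarrow> k < M \<Longrightarrow> (odd k \<longrightarrow> p k * p 1 > 0) \<and> (even k \<longrightarrow> p k * p 0 < 0)"
    and ij: "1 \<le> i" "i < M" "1 \<le> j" "j < M"
  shows "even (i + j) \<Longrightarrow> p i * p j > 0" "odd (i + j) \<Longrightarrow> p 0 * p 1 * (p i * p j) < 0"
proof -
  have i: "(odd i \<longrightarrow> p i * p 1 > 0) \<and> (even i \<longrightarrow> p i * p 0 < 0)"
    and j: "(odd j \<longrightarrow> p j * p 1 > 0) \<and> (even j \<longrightarrow> p j * p 0 < 0)"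
    using pat ij by auto
  show "p i * p j > 0" if "even (i + j)"
    using that i j by (cases "even i") (auto simp: zero_less_mult_iff mult_less_0_iff)
  show "p 0 * p 1 * (p i * p j) < 0" if "odd (i + j)"
    using that i j by (cases "even i") (auto simp: zero_less_mult_iff mult_less_0_iff)
qed

text \<open>In degree \<open>k\<close> the two outer terms give
  \<open>2 * J 0 k * p 0 * p k\<close>. By induction the inner terms share one sign, positive for
  even \<open>k\<close> and that of \<open>- (p 0 * p 1)\<close> for odd \<open>k\<close>, which
  fixes the sign of \<open>p k\<close>. \<open>Jpos\<close> asks for positivity only at nonzero
  coefficients because in the application it is known only up to the second largest exponent; the
  induction supplies the nonvanishing.\<close>

lemma quadratic_recursion_signs:
  fixes p :: "nat \<Rightarrow> real" and J :: "nat \<Rightarrow> nat \<Rightarrow> real"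
  assumes "p 0 \<noteq> 0" "p 1 \<noteq> 0"
    and J0: "\<And>k. 1 \<le> k \<Longrightarrow> k \<le> N \<Longrightarrow> J 0 k > 0 \<and> J k 0 = J 0 k"
    and Jpos: "\<And>i j. 1 \<le> i \<Longrightarrow> i < N \<Longrightarrow> 1 \<le> j \<Longrightarrow> j < N \<Longrightarrow> p i \<noteq> 0 \<Longrightarrow> p j \<noteq> 0 \<Longrightarrow> J i j > 0"
    and rec: "\<And>k. 2 \<le> k \<Longrightarrow> k \<le> N \<Longrightarrow> (\<Sum>i\<le>k. J i (k - i) * p i * p (k - i)) = 0"
  shows "1 \<le> k \<Longrightarrow> k \<le> N \<Longrightarrow> (odd k \<longrightarrow> p k * p 1 > 0) \<and> (even k \<longrightarrow> p k * p 0 < 0)"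
proof (induction k rule: less_induct)
  case (less k)
  show ?case
  proof (cases "k = 1")
    case True
    with assms(2) show ?thesis by (simp add: zero_less_mult_iff) linarith
  next
    case False
    with less have k2: "2 \<le> k" by simp
    have pat: "(odd l \<longrightarrow> p l * p 1 > 0) \<and> (even l \<longrightarrow> p l * p 0 < 0)" if "1 \<le> l" "l < k" for l
      using less.IH[of l] less.prems that by simp
    let ?S = "\<Sum>i\<in>{1..<k}. J i (k - i) * p i * p (k - i)"
    have "{..k} = insert 0 (insert k {1..<k})" using k2 by auto
    with rec[OF k2] less.prems(2) J0[of k] k2 have eq: "2 * J 0 k * p 0 * p k + ?S = 0"
      by (simp add: algebra_simps)
    have Jp: "J i (k - i) > 0" if "1 \<le> i" "i < k" for i
    proof -
      have "p i \<noteq> 0" "p (k - i) \<noteq> 0" using pat[of i] pat[of "k - i"] that by fastforce+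
      then show ?thesis using Jpos[of i "k - i"] that less.prems by auto
    qed
    have Jk: "J 0 k > 0" using J0 less.prems by simp
    show ?thesis
    proof (cases "even k")
      case True
      have "?S > 0"
      proof (rule sum_pos)
        fix i assume i: "i \<in> {1..<k}"
        have "p i * p (k - i) > 0" by (rule alternating_product(1)[OF pat]) (use i True in auto)
        with Jp[of i] i show "J i (k - i) * p i * p (k - i) > 0"
          by (simp add: mult.assoc)
      qed (use k2 in auto)
      with eq have "J 0 k * (p 0 * p k) < 0" by (simp add: algebra_simps)
      with Jk True show ?thesis by (simp add: mult_less_0_iff mult.commute)
    next
      case False
      have "p 0 * p 1 * ?S = (\<Sum>i\<in>{1..<k}. J i (k - i) * (p 0 * p 1 * (p i * p (k - i))))"
        by (simp add: sum_distrib_left algebra_simps)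
      also have "\<dots> < 0"
      proof -
        have "(\<Sum>i\<in>{1..<k}. - (J i (k - i) * (p 0 * p 1 * (p i * p (k - i))))) > 0"
        proof (rule sum_pos)
          fix i assume i: "i \<in> {1..<k}"
          have "p 0 * p 1 * (p i * p (k - i)) < 0" by (rule alternating_product(2)[OF pat]) (use i False in auto)
          with Jp[of i] i show "- (J i (k - i) * (p 0 * p 1 * (p i * p (k - i)))) > 0"
            by (simp add: mult_less_0_iff)
        qed (use k2 in auto)
        then show ?thesis by (simp add: sum_negf)
      qed
      finally have neg: "p 0 * p 1 * ?S < 0" .
      from eq have "2 * J 0 k * p 0 * p k = - ?S" by simp
      then have "p 0 * p 1 * (2 * J 0 k * p 0 * p k) > 0" using neg by simp
      then have "(2 * J 0 k * (p 0 * p 0)) * (p k * p 1) > 0" by (simp add: algebra_simps)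
      moreover have "2 * J 0 k * (p 0 * p 0) > 0"
        using Jk assms(1) by (simp add: zero_less_mult_iff) linarith
      ultimately have "p k * p 1 > 0" using zero_less_mult_pos by blast
      with False show ?thesis by simp
    qed
  qed
qed

text \<open>The two outer terms vanish by \<open>stop\<close>, and the inner ones all have the same
  sign by parity, so they cannot cancel.\<close>

lemma quadratic_recursion_no_stop:
  fixes p :: "nat \<Rightarrow> real" and J :: "nat \<Rightarrow> nat \<Rightarrow> real"
  assumes pat: "\<And>k. 1 \<le> k \<Longrightarrow> k \<le> N \<Longrightarrow> (odd k \<longrightarrow> p k * p 1 > 0) \<and> (even k \<longrightarrow> p k * p 0 < 0)"
    and "N \<ge> 1"
    and Jpos: "\<And>i j. 1 \<le> i \<Longrightarrow> i \<le> N \<Longrightarrow> 1 \<le> j \<Longrightarrow> j \<le> N \<Longrightarrow> i + j = N + 1 \<Longrightarrow> J i j > 0"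
    and stop: "p (N + 1) = 0"
  shows "(\<Sum>i\<le>N+1. J i (N + 1 - i) * p i * p (N + 1 - i)) \<noteq> 0"
proof -
  let ?S = "\<Sum>i\<in>{1..N}. J i (N + 1 - i) * p i * p (N + 1 - i)"
  have "{..N+1} = insert 0 (insert (N + 1) {1..N})" by auto
  then have eq: "(\<Sum>i\<le>N+1. J i (N + 1 - i) * p i * p (N + 1 - i)) = ?S"
    using stop by simp
  have pat': "\<And>k. 1 \<le> k \<Longrightarrow> k < N + 1 \<Longrightarrow> (odd k \<longrightarrow> p k * p 1 > 0) \<and> (even k \<longrightarrow> p k * p 0 < 0)"
    using pat by auto
  show ?thesis
  proof (cases "even (N + 1)")
    case True
    have "?S > 0"
    proof (rule sum_pos)
      fix i assume i: "i \<in> {1..N}"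
      have "p i * p (N + 1 - i) > 0" by (rule alternating_product(1)[OF pat']) (use i True in auto)
      moreover have "J i (N + 1 - i) > 0" by (rule Jpos) (use i in auto)
      ultimately show "J i (N + 1 - i) * p i * p (N + 1 - i) > 0"
        by (metis mult.assoc mult_pos_pos)
    qed (use \<open>N \<ge> 1\<close> in auto)
    with eq show ?thesis by simp
  next
    case False
    have "(\<Sum>i\<in>{1..N}. - (J i (N + 1 - i) * (p 0 * p 1 * (p i * p (N + 1 - i))))) > 0"
    proof (rule sum_pos)
      fix i assume i: "i \<in> {1..N}"
      have "p 0 * p 1 * (p i * p (N + 1 - i)) < 0"
        by (rule alternating_product(2)[OF pat']) (use i False in auto)
      moreover have "J i (N + 1 - i) > 0" by (rule Jpos) (use i in auto)
      ultimately show "- (J i (N + 1 - i) * (p 0 * p 1 * (p i * p (N + 1 - i)))) > 0"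
        by (metis mult_pos_neg neg_0_less_iff_less)
    qed (use \<open>N \<ge> 1\<close> in auto)
    also have "(\<Sum>i\<in>{1..N}. - (J i (N + 1 - i) * (p 0 * p 1 * (p i * p (N + 1 - i))))) = - (p 0 * p 1 * ?S)"
      by (simp add: sum_distrib_left sum_negf algebra_simps)
    finally show ?thesis using eq by auto
  qed
qed

text \<open>For null \<open>cb\<close>, with \<open>P\<close> the value of the form at
  \<open>cb\<close>, \<open>\<delta>\<close> and \<open>Q\<close> its value at
  \<open>\<delta>\<close>, \<open>\<delta>\<close>, the formula \<open>J_eq\<close> is its value at
  \<open>cb + s \<delta>\<close>, \<open>cb + t \<delta>\<close>. \<open>T\<close> holds the
  parameters of the points of \<open>C\<close> on the line; the degrees 1 and
  \<open>\<gamma>\<close> belong to the weights \<open>v\<close> and \<open>w\<close>.\<close>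

locale line_equation =
  fixes T :: "real set" and g :: "real \<Rightarrow> real" and P Q A B \<gamma> :: real and J :: "real \<Rightarrow> real \<Rightarrow> real"
  assumes J_eq: "J s t = P * (s + t) + Q * s * t"
    and fin: "finite T" and T0: "0 \<in> T" and nonneg: "t \<in> T \<Longrightarrow> 0 \<le> t"
    and g_nz: "t \<in> T \<Longrightarrow> g t \<noteq> 0"
    and P: "P \<noteq> 0" and Q: "Q < 0" and A: "A \<noteq> 0" and B: "B \<noteq> 0" and \<gamma>: "1 < \<gamma>"
    and eqn: "(\<Sum>p\<in>{p. fst p \<in> T \<and> snd p \<in> T \<and> fst p + snd p = \<tau>}. J (fst p) (snd p) * g (fst p) * g (snd p))
                = (if \<tau> = 1 then A else if \<tau> = \<gamma> then B else 0)"
begin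

lemma J_commute: "J s t = J t s"
  by (simp add: J_eq algebra_simps)

lemma unique_pair:
  assumes "s \<in> T" "t \<in> T" "s + t \<noteq> 1" "s + t \<noteq> \<gamma>"
    and "\<And>x y. x \<in> T \<Longrightarrow> y \<in> T \<Longrightarrow> x + y = s + t \<Longrightarrow> x = s \<or> x = t"
  shows "J s t = 0"
  using unique_pair_zero[of J s t T g, OF J_commute assms(1,2) g_nz[OF assms(1)] g_nz[OF assms(2)] assms(5)]
    eqn[of "s + t"] assms(3,4) by simp

lemma pair_exists: 
  assumes "\<tau> = 1 \<or> \<tau> = \<gamma>"
  obtains x y where "x \<in> T" "y \<in> T" "x + y = \<tau>"
proof -
  have "{p. fst p \<in> T \<and> snd p \<in> T \<and> fst p + snd p = \<tau>} \<noteq> {}"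
    using eqn[of \<tau>] A B assms by (metis sum.empty)
  then show ?thesis using that by auto
qed

text \<open>The smallest positive exponent m is a sum of two exponents only as 0 + m, and
  \<open>J 0 m = P * m\<close> is nonzero, so m is 1 or \<open>\<gamma>\<close>. It cannot be
  \<open>\<gamma> > 1\<close>, as 1 has to be a sum of two exponents.\<close>

lemma one_in_T: "1 \<in> T" and ge_one: "t \<in> T \<Longrightarrow> t \<noteq> 0 \<Longrightarrow> 1 \<le> t"
proof -
  let ?m = "Min (T - {0})"
  obtain x y where xy: "x \<in> T" "y \<in> T" "x + y = 1" using pair_exists by blast
  then have ne: "T - {0} \<noteq> {}" by (cases "x = 0") auto
  have m: "?m \<in> T - {0}" and le: "?m \<le> t" if "t \<in> T - {0}" for t
    using Min_in[OF _ ne] Min_le[OF _ that] fin by auto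
  have mT: "?m \<in> T" "?m > 0" using m ne nonneg by (auto simp: less_le)
  have "?m = 1"
  proof (rule ccontr)
    assume m1: "?m \<noteq> 1"
    have "?m = \<gamma>"
    proof (rule ccontr)
      assume "?m \<noteq> \<gamma>"
      with m1 have "J 0 ?m = 0"
      proof (intro unique_pair T0 mT(1))
        fix u v assume uv: "u \<in> T" "v \<in> T" "u + v = 0 + ?m"
        show "u = 0 \<or> u = ?m"
        proof (cases "u = 0")
          case False
          then have "?m \<le> u" using uv le by auto
          with uv nonneg[of v] show ?thesis by simp
        qed simp
      qed auto
      with P mT(2) show False by (simp add: J_eq)
    qed
    moreover have "?m \<le> x \<or> ?m \<le> y" using xy le[of x] le[of y] by force
    ultimately show False using xy \<gamma> nonneg[of x] nonneg[of y] by linarith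
  qed
  then show "1 \<in> T" "t \<in> T \<Longrightarrow> t \<noteq> 0 \<Longrightarrow> 1 \<le> t" using mT(1) le[of t] by auto
qed

text \<open>A least non-natural exponent x would be a sum of exponents only as 0 + x, since smaller
  ones have natural sums. The bound by \<open>\<gamma>\<close> keeps the right-hand side in degree x
  at 0, against \<open>J 0 x = P * x\<close>.\<close>

lemma nat_valued:
  assumes "\<And>t. t \<in> T \<Longrightarrow> t < \<gamma>"
  shows "t \<in> T \<Longrightarrow> \<exists>n. t = real n"
proof (rule ccontr)
  let ?X = "{t \<in> T. \<not> (\<exists>n. t = real n)}"
  assume "t \<in> T" "\<not> (\<exists>n. t = real n)"
  then have ne: "?X \<noteq> {}" and fX: "finite ?X" using fin by auto
  define x where "x = Min ?X"
  have x: "x \<in> T" "\<not> (\<exists>n. x = real n)" using Min_in[OF fX ne] by (auto simp: x_def)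
  have small: "\<exists>n. u = real n" if "u \<in> T" "u < x" for u
    using Min_le[OF fX, of u] that by (auto simp: x_def)
  have x0: "x > 0" using x nonneg[of x] by (metis less_eq_real_def of_nat_0)
  have "J 0 x = 0"
  proof (intro unique_pair T0 x(1))
    show "0 + x \<noteq> 1" using x(2) by (metis add_0 of_nat_1)
    show "0 + x \<noteq> \<gamma>" using assms[OF x(1)] by simp
    fix u v assume uv: "u \<in> T" "v \<in> T" "u + v = 0 + x"
    show "u = 0 \<or> u = x"
    proof (rule ccontr)
      assume neg: "\<not> (u = 0 \<or> u = x)"
      then have "u < x" "v < x" using uv nonneg[of u] nonneg[of v] by auto
      then obtain m n where "u = real m" "v = real n" using small uv by blast
      with uv(3) x(2) show False by (metis add_0 of_nat_add)
    qed
  qed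
  with P x0 show False by (simp add: J_eq)
qed

text \<open>\<open>M\<close> is the second largest exponent. The sign pattern makes all coefficients
  up to degree \<open>N\<close> nonzero, hence \<open>M = N - 1\<close> and
  \<open>\<gamma> \<ge> 2 * N - 1 > N + 1\<close>. So the right-hand side in degree
  \<open>N + 1\<close> is 0, while the terms there cannot cancel.\<close>

lemma long_spectrum:
  assumes nat: "\<And>t. t \<in> T \<Longrightarrow> \<exists>n. t = real n"
    and N: "real N \<in> T" "\<And>t. t \<in> T \<Longrightarrow> t \<le> real N" "N \<ge> 3"
    and M: "M \<in> T" "M < N" "\<And>t. t \<in> T \<Longrightarrow> t \<noteq> real N \<Longrightarrow> t \<le> M"
    and P0: "P > 0"
    and \<gamma>N: "\<gamma> \<ge> real N + M"
    and Jpos: "\<And>s t. 0 < s \<Longrightarrow> s \<le> M \<Longrightarrow> 0 < t \<Longrightarrow> t \<le> M \<Longrightarrow> J s t > 0"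
    and JposN: "\<And>s. 0 \<le> s \<Longrightarrow> s < M \<Longrightarrow> J s N > 0"
  shows False
proof -
  define p where "p = (\<lambda>n. if real n \<in> T then g (real n) else 0)"
  define JJ where "JJ = (\<lambda>i j. J (real i) (real j))"
  have M1: "1 \<le> M" using M(3)[OF one_in_T] N(3) by simp
  have rec: "(\<Sum>i\<le>k. JJ i (k - i) * p i * p (k - i)) = 0" if "2 \<le> k" "real k \<noteq> \<gamma>" for k
    using sum_pairs_nat[OF fin nat, of J g k] eqn[of "real k"] that by (simp add: p_def JJ_def)
  have pnz: "p k \<noteq> 0 \<longleftrightarrow> real k \<in> T" for k using g_nz by (auto simp: p_def)
  have pat: "(odd k \<longrightarrow> p k * p 1 > 0) \<and> (even k \<longrightarrow> p k * p 0 < 0)" if "1 \<le> k" "k \<le> N" for k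
  proof (rule quadratic_recursion_signs[of p N JJ, OF _ _ _ _ _ that])
    show "p 0 \<noteq> 0" "p 1 \<noteq> 0" using pnz[of 0] pnz[of 1] T0 one_in_T by auto
    show "0 < JJ 0 k \<and> JJ k 0 = JJ 0 k" if "1 \<le> k" "k \<le> N" for k
      using that P0 by (simp add: JJ_def J_eq)
    show "0 < JJ i j" if "1 \<le> i" "i < N" "1 \<le> j" "j < N" "p i \<noteq> 0" "p j \<noteq> 0" for i j
      using that M(3)[of i] M(3)[of j] unfolding JJ_def pnz by (intro Jpos) auto
    show "(\<Sum>i\<le>k. JJ i (k - i) * p i * p (k - i)) = 0" if "2 \<le> k" "k \<le> N" for k
      using that \<gamma>N M1 by (intro rec) auto
  qed
  have "p (N - 1) \<noteq> 0" using pat[of "N - 1"] N(3) by fastforce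
  then have "real (N - 1) \<le> M" using M(3)[of "real (N - 1)"] N(3) by (simp add: pnz)
  moreover obtain m where m: "M = real m" using nat M(1) by blast
  ultimately have MN: "M = real (N - 1)" using M(2) by simp
  have "JJ i j > 0" if "1 \<le> i" "i \<le> N" "1 \<le> j" "j \<le> N" "i + j = N + 1" for i j
  proof -
    note ij = that
    consider "i < N" "j < N" | "i = N" "j = 1" | "j = N" "i = 1" using ij by linarith
    then show ?thesis
    proof cases
      case 1
      with that show ?thesis unfolding JJ_def by (intro Jpos) (auto simp: MN)
    next
      case 2
      with JposN[of 1] N(3) show ?thesis by (simp add: JJ_def MN J_commute)
    next
      case 3
      with JposN[of 1] N(3) show ?thesis by (simp add: JJ_def MN)
    qed
  qed
  moreover have "p (N + 1) = 0" using N(2)[of "real (N + 1)"] pnz[of "N + 1"] by force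
  ultimately have "(\<Sum>i\<le>N+1. JJ i (N + 1 - i) * p i * p (N + 1 - i)) \<noteq> 0"
    using N(3) by (intro quadratic_recursion_no_stop pat) auto
  with rec[of "N + 1"] \<gamma>N MN N(3) show False by auto
qed

text \<open>For the two largest exponents M < m, the sums 2m and M + m arise in one way only. Hence
  either \<open>2 * m = \<gamma>\<close> and \<open>J M m = 0\<close>, or \<open>J m m = 0\<close>
  and \<open>\<gamma> = M + m\<close>. In both cases the form is positive where
  \<open>long_spectrum\<close> requires it, which leaves m = 2; the case m = 1 is separate.\<close>

lemma classification:
  "(T = {0,1} \<and> \<gamma> = 2) \<or> (T = {0,1,2} \<and> \<gamma> = 4 \<and> 3 * P + 2 * Q = 0)
     \<or> (T = {0,1,2} \<and> \<gamma> = 3 \<and> P + Q = 0 \<and> A * B < 0)"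
proof -
  define m where "m = Max T"
  have m: "m \<in> T" and le_m: "t \<le> m" if "t \<in> T" for t
    using Max_in[OF fin] Max_ge[OF fin that] T0 by (auto simp: m_def)
  have mT: "m \<in> T" using m T0 by blast
  have m1: "1 \<le> m" using le_m one_in_T by blast
  have top: "J m m = 0 \<or> 2 * m = \<gamma>"
  proof (rule ccontr)
    assume neg: "\<not> ?thesis"
    have "J m m = 0"
    proof (intro unique_pair mT)
      show "m + m \<noteq> 1" "m + m \<noteq> \<gamma>" using m1 neg by auto
      show "u = m \<or> u = m" if "u \<in> T" "v \<in> T" "u + v = m + m" for u v
        using that le_m[of u] le_m[of v] by auto
    qed
    with neg show False by simp
  qed
  show ?thesis
  proof (cases "m = 1")
    case True
    then have T: "T = {0, 1}" using T0 one_in_T ge_one le_m by force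
    obtain x y where "x \<in> T" "y \<in> T" "x + y = \<gamma>" using pair_exists by blast
    with T \<gamma> show ?thesis by auto
  next
    case False
    with m1 have m1: "1 < m" by simp
    have null_top: "P * 2 + Q * m = 0" if "J m m = 0"
    proof -
      have "m * (P * 2 + Q * m) = 0" using that by (simp add: J_eq algebra_simps)
      with m1 show ?thesis by simp
    qed
    define M where "M = Max (T - {m})"
    have ne: "T - {m} \<noteq> {}" "finite (T - {m})" using T0 m1 fin by auto
    have M: "M \<in> T" "M \<noteq> m" using Max_in[OF ne(2,1)] by (auto simp: M_def)
    have le_M: "t \<le> M" if "t \<in> T" "t \<noteq> m" for t using Max_ge[OF ne(2)] that by (auto simp: M_def)
    have M1: "1 \<le> M" using le_M[OF one_in_T] m1 by auto
    have Mm: "M < m" using le_m[OF M(1)] M(2) by simp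
    have second: "J M m = 0 \<or> M + m = \<gamma>"
    proof (rule ccontr)
      assume neg: "\<not> ?thesis"
      have "J M m = 0"
      proof (intro unique_pair mT M)
        show "M + m \<noteq> 1" "M + m \<noteq> \<gamma>" using m1 M1 neg by auto
        show "u = M \<or> u = m" if "u \<in> T" "v \<in> T" "u + v = M + m" for u v
          using that le_m[of u] le_m[of v] le_M[of u] le_M[of v] Mm by (cases "u = m"; cases "v = m") auto
      qed
      with neg show False by simp
    qed
    \<comment> \<open>Integrality of the exponents, via \<open>nat_valued\<close>, depends on this
      bound.\<close>
    have lt: "m < \<gamma>"
    proof (cases "2 * m = \<gamma>")
      case True then show ?thesis using m1 by simp
    next
      case False
      with top null_top have "P * 2 + Q * m = 0" by blast
      then have "J M m = Q / 2 * (m * (M - m))" by (simp add: J_eq field_simps) algebra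
      with second Q m1 Mm have "M + m = \<gamma>" by simp
      with M1 show ?thesis by simp
    qed
    then have nat: "\<exists>n. t = real n" if "t \<in> T" for t
      using nat_valued le_m that by fastforce
    obtain N where N: "m = real N" using nat mT by blast
    have N2: "N \<ge> 2" using m1 N by auto
    obtain L where L: "M = real L" using nat M by blast
    have LN: "1 \<le> L" "L < N" using M1 Mm L N by auto
    have T2: "M = 1 \<and> T = {0, 1, 2}" if "N = 2"
    proof
      show M1: "M = 1" using LN L that by simp
      show "T = {0, 1, 2}"
      proof (intro equalityI subsetI)
        fix t assume t: "t \<in> T"
        show "t \<in> {0, 1, 2}"
          using ge_one[OF t] le_M[OF t] N that M1 by force
      qed (use T0 one_in_T mT N that in auto)
    qed
    show ?thesis
    proof (cases "2 * m = \<gamma>")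
      case True
      with second Mm have J0: "J M m = 0" by auto
      have pos: "M + m > 0" using M1 m1 by simp
      have Peq: "P = - Q * (M * m / (M + m))" using J0 pos by (simp add: J_eq field_simps)
      \<comment> \<open>Eliminating \<open>P\<close> by \<open>J M m = 0\<close> leaves
        \<open>- Q > 0\<close> times a sum whose positivity is visible for parameters up to
        \<open>M\<close>. Below, \<open>J m m = 0\<close> plays the same part.\<close>
      have Jeq: "J s t * (M + m) = - Q * (M * s * (m - t) + m * t * (M - s))" for s t
        using J0 by (simp add: J_eq) algebra
      show ?thesis
      proof (cases "N = 2")
        case True
        with T2 J0 N \<open>2 * m = \<gamma>\<close> show ?thesis by (simp add: J_eq)
      next
        case False
        have "False"
        proof (rule long_spectrum[OF nat, of N M])
          show "P > 0" unfolding Peq using Q M1 m1 pos by (intro mult_pos_pos divide_pos_pos) auto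
          show "real N + M \<le> \<gamma>" using True N Mm by simp
          fix s t :: real assume st: "0 < s" "s \<le> M" "0 < t" "t \<le> M"
          have "M * s * (m - t) + m * t * (M - s) > 0"
            using st Mm M1 by (intro add_pos_nonneg mult_pos_pos mult_nonneg_nonneg) auto
          then have "J s t * (M + m) > 0" unfolding Jeq using Q by (simp add: mult_neg_pos)
          then show "J s t > 0" using pos by (simp add: zero_less_mult_iff)
        next
          fix s :: real assume s: "0 \<le> s" "s < M"
          have "M * s * (m - m) + m * m * (M - s) > 0" using s m1 by simp
          then have "J s m * (M + m) > 0" unfolding Jeq using Q by (simp add: mult_neg_pos)
          then show "J s (real N) > 0" using pos N by (simp add: zero_less_mult_iff)
        qed (use N N2 False M Mm mT le_m le_M in auto)
        then show ?thesis ..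
      qed
    next
      case False
      with top null_top have Pm: "P * 2 + Q * m = 0" by blast
      then have P2: "P = - Q * m / 2" by simp
      then have P0: "P > 0" using Q m1 by (simp add: mult_neg_pos)
      have Jeq: "J s t = - Q / 2 * (s * (m - t) + t * (m - s))" for s t
        unfolding J_eq P2 by (simp add: field_simps)
      have "J M m \<noteq> 0" unfolding Jeq using Q m1 Mm by simp
      with second have \<gamma>M: "\<gamma> = M + m" by simp
      show ?thesis
      proof (cases "N = 2")
        case True
        then have T: "T = {0, 1, 2}" and g3: "\<gamma> = 3" and PQ: "P + Q = 0"
          using T2 \<gamma>M N Pm by auto
        \<comment> \<open>Degree 2 will give \<open>4 * (g 0 * g 2) = - (g 1 * g 1)\<close>, so the
          product of the equations in degrees 1 and 3 is negative.\<close>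
        have sums: "{p. fst p \<in> T \<and> snd p \<in> T \<and> fst p + snd p = 1} = {(0,1),(1,0)}"
          "{p. fst p \<in> T \<and> snd p \<in> T \<and> fst p + snd p = 2} = {(0,2),(1,1),(2,0)}"
          "{p. fst p \<in> T \<and> snd p \<in> T \<and> fst p + snd p = 3} = {(1,2),(2,1)}"
          unfolding T by auto
        have A: "2 * P * g 0 * g 1 = A"
          using eqn[of 1] unfolding sums by (simp add: J_eq mult_ac)
        have Q': "Q = - P" using PQ by simp
        have B: "2 * P * g 1 * g 2 = B"
          using eqn[of 3] g3 unfolding sums by (simp add: J_eq Q')
        have "4 * P * g 0 * g 2 + P * g 1 * g 1 = 0"
          using eqn[of 2] g3 unfolding sums by (simp add: J_eq Q')
        then have "4 * (g 0 * g 2) = - (g 1 * g 1)" using P by algebra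
        then have "A * B = - (P * g 1 * g 1)\<^sup>2" unfolding A[symmetric] B[symmetric] by algebra
        moreover have "P * g 1 * g 1 \<noteq> 0" using P g_nz one_in_T by simp
        ultimately have "A * B < 0" by simp
        with T g3 PQ show ?thesis by blast
      next
        case False
        have "False"
        proof (rule long_spectrum[OF nat, of N M])
          show "P > 0" by (rule P0)
          show "real N + M \<le> \<gamma>" using \<gamma>M N by simp
          fix s t :: real assume st: "0 < s" "s \<le> M" "0 < t" "t \<le> M"
          have "s * (m - t) + t * (m - s) > 0"
            using st Mm by (intro add_pos_pos mult_pos_pos) auto
          then show "J s t > 0" unfolding Jeq using Q by (simp add: mult_neg_pos)
        next
          fix s :: real assume s: "0 \<le> s" "s < M"
          have "s * (m - m) + m * (m - s) > 0" using s m1 Mm by simp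
          then show "J s (real N) > 0" unfolding Jeq using Q N by (simp add: mult_neg_pos)
        qed (use N N2 False M Mm mT le_m le_M in auto)
        then show ?thesis ..
      qed
    qed
  qed
qed

end

subsection \<open>Edges at a null vertex\<close>

lemma open_segment_of_positive:
  fixes x :: "'a::real_vector"
  assumes "\<alpha> > 0" "\<beta> > 0" "(\<alpha> + \<beta>) *\<^sub>R x = \<alpha> *\<^sub>R u + \<beta> *\<^sub>R v" "u \<noteq> v"
  shows "x \<in> open_segment u v"
proof -
  have "x = inverse (\<alpha> + \<beta>) *\<^sub>R ((\<alpha> + \<beta>) *\<^sub>R x)" using assms(1,2) by simp
  also have "\<dots> = (\<alpha> / (\<alpha> + \<beta>)) *\<^sub>R u + (\<beta> / (\<alpha> + \<beta>)) *\<^sub>R v"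
    unfolding assms(3) by (simp add: scaleR_add_right divide_inverse mult.commute)
  also have "\<alpha> / (\<alpha> + \<beta>) = 1 - \<beta> / (\<alpha> + \<beta>)" using assms by (simp add: field_simps)
  finally show ?thesis
    using assms unfolding in_segment by (intro conjI exI[of _ "\<beta> / (\<alpha> + \<beta>)"]) auto
qed

lemma convex_directions:
  fixes S :: "'a::real_vector set"
  assumes "convex S"
  shows "convex {\<eta>. \<exists>s>0. c + s *\<^sub>R \<eta> \<in> S}"
  unfolding convex_alt
proof clarify
  fix x y :: 'a and u s t :: real
  assume u: "0 \<le> u" "u \<le> 1" and s: "0 < s" "c + s *\<^sub>R x \<in> S" and t: "0 < t" "c + t *\<^sub>R y \<in> S"
  \<comment> \<open>\<open>k\<close> is the total weight when \<open>(1 - u) x + u y\<close> is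
    written in the vectors \<open>s x\<close> and \<open>t y\<close>, which lead from
    \<open>c\<close> into \<open>S\<close>; dividing by it yields a convex combination.\<close>
  define k where "k = (1 - u) / s + u / t"
  have k: "k > 0"
  proof (cases "u = 0")
    case False
    then show ?thesis unfolding k_def using u s t by (intro add_nonneg_pos) auto
  qed (use s in \<open>simp add: k_def\<close>)
  define \<mu> where "\<mu> = u / t / k"
  have m1: "1 - \<mu> = (1 - u) / s / k" 
  proof -
    have "(1 - u) / s = k - u / t" by (simp add: k_def)
    with k show ?thesis by (simp add: \<mu>_def diff_divide_distrib)
  qed
  have "0 \<le> \<mu>" "0 \<le> 1 - \<mu>" unfolding m1 using u s t k by (auto simp: \<mu>_def)
  then have "(1 - \<mu>) *\<^sub>R (c + s *\<^sub>R x) + \<mu> *\<^sub>R (c + t *\<^sub>R y) \<in> S"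
    using assms s t unfolding convex_alt by simp
  also have "(1 - \<mu>) *\<^sub>R (c + s *\<^sub>R x) + \<mu> *\<^sub>R (c + t *\<^sub>R y)
       = c + (((1 - \<mu>) * s) *\<^sub>R x + (\<mu> * t) *\<^sub>R y)"
    by (simp add: algebra_simps)
  also have "(1 - \<mu>) * s = (1 / k) * (1 - u)" unfolding m1 using s by simp
  also have "\<mu> * t = (1 / k) * u" using t by (simp add: \<mu>_def)
  also have "((1 / k) * (1 - u)) *\<^sub>R x + ((1 / k) * u) *\<^sub>R y = (1 / k) *\<^sub>R ((1 - u) *\<^sub>R x + u *\<^sub>R y)"
    by (simp add: scaleR_add_right)
  finally show "\<exists>s>0. c + s *\<^sub>R ((1 - u) *\<^sub>R x + u *\<^sub>R y) \<in> S" using k by (intro exI[of _ "1 / k"]) simp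
qed

text \<open>Removing an extreme point leaves the hull convex, so \<open>c\<close> lies outside the
  compact hull of the other points and is strictly separated from it.\<close>

lemma extreme_point_supporting:
  fixes C :: "'a::euclidean_space set"
  assumes "finite C" "c extreme_point_of (convex hull C)"
  obtains l where "\<And>x. x \<in> C \<Longrightarrow> x \<noteq> c \<Longrightarrow> l \<bullet> (x - c) > 0"
proof -
  have "convex (convex hull C - {c})"
    using assms(2) extreme_point_of_stillconvex[OF convex_convex_hull] by blast
  then have "convex hull (C - {c}) \<subseteq> convex hull C - {c}"
    by (intro hull_minimal) (auto simp: hull_inc)
  then have "c \<notin> convex hull (C - {c})" by blast
  moreover have "closed (convex hull (C - {c}))"
    using assms(1) by (simp add: compact_imp_closed finite_imp_compact_convex_hull)
  ultimately obtain l b where l: "l \<bullet> c < b" "\<forall>x\<in>convex hull (C - {c}). l \<bullet> x > b"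
    using separating_hyperplane_closed_point[OF convex_convex_hull] by metis
  have "l \<bullet> (x - c) > 0" if "x \<in> C" "x \<noteq> c" for x
    using l hull_inc[of x "C - {c}" convex] that by (force simp: inner_diff_right)
  then show ?thesis using that by blast
qed

text \<open>The tangent cone of a polytope at a vertex is generated by the rays in the directions of its edges. The
  innermost premise of \<open>edge\<close> expresses that \<open>\<eta>\<close> is such a direction.\<close>
lemma reach_from_edges:
  fixes C :: "'a::euclidean_space set"
  assumes fin: "finite C" and ext: "c extreme_point_of (convex hull C)" and "convex S"
    and edge: "\<And>\<eta> x\<^sub>0 s\<^sub>0. \<lbrakk>\<eta> \<noteq> 0; x\<^sub>0 \<in> C; s\<^sub>0 > 0; x\<^sub>0 = c + s\<^sub>0 *\<^sub>R \<eta>;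
        \<And>x y \<tau>. x \<in> C \<Longrightarrow> y \<in> C \<Longrightarrow> x + y = 2 *\<^sub>R c + \<tau> *\<^sub>R \<eta> \<Longrightarrow> \<exists>s\<ge>0. x = c + s *\<^sub>R \<eta>\<rbrakk>
        \<Longrightarrow> \<exists>s>0. c + s *\<^sub>R \<eta> \<in> S"
    and x: "x \<in> C" "x \<noteq> c"
  shows "\<exists>s>0. c + s *\<^sub>R (x - c) \<in> S"
proof -
  obtain l where l: "\<And>x. x \<in> C \<Longrightarrow> x \<noteq> c \<Longrightarrow> l \<bullet> (x - c) > 0"
    using extreme_point_supporting[OF fin ext] by blast
  \<comment> \<open>\<open>\<pi>\<close> scales directions at \<open>c\<close> into the slice where
    \<open>l\<close> is 1. The hull of the scaled directions is the vertex figure, whose vertices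
    are the edge directions.\<close>
  define \<pi> where "\<pi> = (\<lambda>x. (1 / (l \<bullet> (x - c))) *\<^sub>R (x - c))"
  let ?X = "\<pi> ` (C - {c})"
  let ?K = "{\<eta>. \<exists>s>0. c + s *\<^sub>R \<eta> \<in> S}"
  have \<pi>: "x = c + (l \<bullet> (x - c)) *\<^sub>R \<pi> x" "l \<bullet> \<pi> x = 1" if "x \<in> C" "x \<noteq> c" for x
    using l[OF that] by (auto simp: \<pi>_def)
  have "\<eta> \<in> ?K" if \<eta>: "\<eta> extreme_point_of (convex hull ?X)" for \<eta>
  proof -
    have "\<eta> \<in> ?X" using \<eta> extreme_points_of_convex_hull by blast
    then obtain x\<^sub>0 where x0: "x\<^sub>0 \<in> C" "x\<^sub>0 \<noteq> c" "\<eta> = \<pi> x\<^sub>0" by blast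
    then have l\<eta>: "l \<bullet> \<eta> = 1" using \<pi> by simp
    show ?thesis
    proof (intro CollectI edge)
      show "\<eta> \<noteq> 0" using l\<eta> by auto
      show "x\<^sub>0 \<in> C" "l \<bullet> (x\<^sub>0 - c) > 0" "x\<^sub>0 = c + (l \<bullet> (x\<^sub>0 - c)) *\<^sub>R \<eta>"
        using x0 l \<pi> by auto
      fix x y \<tau> assume xy: "x \<in> C" "y \<in> C" and sum: "x + y = 2 *\<^sub>R c + \<tau> *\<^sub>R \<eta>"
      from sum have sum': "(x - c) + (y - c) = \<tau> *\<^sub>R \<eta>" by (simp add: scaleR_2 algebra_simps)
      show "\<exists>s\<ge>0. x = c + s *\<^sub>R \<eta>"
      proof (cases "x = c")
        case False
        note xc = this
        show ?thesis
        proof (cases "y = c")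
          case True
          with sum' have x': "x - c = \<tau> *\<^sub>R \<eta>" by simp
          then have "l \<bullet> (x - c) = \<tau>" using l\<eta> by simp
          with l[OF xy(1) xc] have "\<tau> \<ge> 0" by simp
          with x' show ?thesis by (intro exI[of _ \<tau>]) (simp add: algebra_simps)
        next
          case False
          \<comment> \<open>With these heights as weights, \<open>\<eta>\<close> is a mean of
            \<open>\<pi> x\<close> and \<open>\<pi> y\<close>; extremality makes all three equal, so
            \<open>x\<close> is on the ray.\<close>
          define \<alpha> \<beta> where "\<alpha> = l \<bullet> (x - c)" and "\<beta> = l \<bullet> (y - c)"
          have pos: "\<alpha> > 0" "\<beta> > 0" using l xy xc False by (auto simp: \<alpha>_def \<beta>_def)
          have "\<alpha> + \<beta> = l \<bullet> ((x - c) + (y - c))" by (simp add: \<alpha>_def \<beta>_def inner_add_right)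
          also have "\<dots> = \<tau>" unfolding sum' using l\<eta> by simp
          finally have "(\<alpha> + \<beta>) *\<^sub>R \<eta> = (x - c) + (y - c)" using sum' by simp
          also have "x - c = \<alpha> *\<^sub>R \<pi> x" using \<pi>(1)[OF xy(1) xc] by (simp add: \<alpha>_def algebra_simps)
          also have "y - c = \<beta> *\<^sub>R \<pi> y" using \<pi>(1)[OF xy(2) False] by (simp add: \<beta>_def algebra_simps)
          finally have comb: "(\<alpha> + \<beta>) *\<^sub>R \<eta> = \<alpha> *\<^sub>R \<pi> x + \<beta> *\<^sub>R \<pi> y" .
          have "\<eta> \<notin> open_segment (\<pi> x) (\<pi> y)"
            using \<eta> xy xc False unfolding extreme_point_of_def by (auto simp: hull_inc)
          with open_segment_of_positive[OF pos comb] have eq: "\<pi> x = \<pi> y" by blast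
          with comb have "(\<alpha> + \<beta>) *\<^sub>R \<eta> = (\<alpha> + \<beta>) *\<^sub>R \<pi> x" by (simp add: algebra_simps)
          then have "\<eta> = \<pi> x" using pos by simp
          with \<pi>(1)[OF xy(1) xc] pos show ?thesis
            by (intro exI[of _ \<alpha>]) (simp add: \<alpha>_def)
        qed
      qed auto
    qed
  qed
  then have "convex hull {\<eta>. \<eta> extreme_point_of (convex hull ?X)} \<subseteq> ?K"
    by (intro hull_minimal convex_directions[OF \<open>convex S\<close>]) auto
  then have "convex hull ?X \<subseteq> ?K"
    using Krein_Milman_polytope[of ?X] fin by simp
  moreover have "\<pi> x \<in> convex hull ?X" using x by (intro hull_inc) auto
  ultimately have "\<pi> x \<in> ?K" by blast
  then obtain s where s: "s > 0" "c + s *\<^sub>R \<pi> x \<in> S" by blast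
  then have "c + (s / (l \<bullet> (x - c))) *\<^sub>R (x - c) \<in> S" by (simp add: \<pi>_def)
  with s(1) l[OF x] show ?thesis by (intro exI[of _ "s / (l \<bullet> (x - c))"]) simp
qed

section \<open>The form \<open>Jf\<close> and the directions of \<open>C\<close> at a null
  vertex\<close>

lemma csum_simps [simp]:
  "csum (x + y) = csum x + csum y" "csum (x - y) = csum x - csum y" "csum (k *\<^sub>R x) = k * csum x"
  "csum (- x) = - csum x" "csum (axis i k) = k" "csum (dvec d) = real (ndim d)"
  by (simp_all add: csum_def dvec_def ndim_def sum.distrib sum_subtractf sum_distrib_left sum_negf axis_def)

lemma Jf_commute: "Jf d x y = Jf d y x"
  by (simp add: Jf_def mult.commute)

lemma Jf_add_left: "Jf d (x + y) z = Jf d x z + Jf d y z"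
  by (simp add: Jf_def add_divide_distrib sum.distrib distrib_right)

lemma Jf_scaleR_left: "Jf d (k *\<^sub>R x) z = k * Jf d x z"
  by (simp add: Jf_def right_diff_distrib sum_distrib_left mult.assoc)

lemma Jf_add_right: "Jf d x (y + z) = Jf d x y + Jf d x z"
  using Jf_add_left Jf_commute by metis

lemma Jf_scaleR_right: "Jf d x (k *\<^sub>R z) = k * Jf d x z"
  using Jf_scaleR_left Jf_commute by metis

lemma Jf_line:
  assumes "Jf d c c = 0"
  shows "Jf d (c + s *\<^sub>R \<eta>) (c + t *\<^sub>R \<eta>) = Jf d c \<eta> * (s + t) + Jf d \<eta> \<eta> * s * t"
  using assms by (simp add: Jf_add_left Jf_add_right Jf_scaleR_left Jf_scaleR_right Jf_commute[of d \<eta> c] algebra_simps)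

lemma Jf_neg_definite:
  assumes "\<forall>i. d i > 0" "csum x = 0" "x \<noteq> 0"
  shows "Jf d x x < 0"
proof -
  obtain i where i: "x $ i \<noteq> 0" using assms(3) by (auto simp: vec_eq_iff)
  have "(\<Sum>i\<in>UNIV. x $ i * x $ i / real (d i)) > 0"
    using assms(1) i by (intro sum_pos2[of _ i]) (auto simp: zero_less_mult_iff linorder_neq_iff)
  then show ?thesis using assms(2) by (simp add: Jf_def)
qed

lemma bar_on_line: "bar d (2 *\<^sub>R c - dvec d + t *\<^sub>R \<eta>) = c + (t / 2) *\<^sub>R \<eta>"
  by (simp add: bar_def scaleR_add_right)

lemma bar_minus_dvec: "bar d (x - dvec d) = (1/2) *\<^sub>R x"
  by (simp add: bar_def)

text \<open>Otherwise the equation at \<open>x + y\<close> has right-hand side 0, and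
  \<open>unique_pair_zero\<close> applies. The midpoint appears as \<open>bar d\<close> of the
  weight \<open>x + y - dvec d\<close>.\<close>

lemma superpotential_unique_sum:
  assumes "is_superpotential d W A C F" "x \<in> C" "y \<in> C" "Jf d x y \<noteq> 0"
    and "\<And>x' y'. x' \<in> C \<Longrightarrow> y' \<in> C \<Longrightarrow> x' + y' = x + y \<Longrightarrow> x' = x \<or> x' = y"
  shows "(1/2) *\<^sub>R (x + y) \<in> bar d ` W"
proof -
  have "x + y - dvec d \<in> W"
  proof (rule ccontr)
    assume "x + y - dvec d \<notin> W"
    then have "Jf d x y = 0"
      using assms by (intro unique_pair_zero[of "Jf d" x y C F]) (auto simp: is_superpotential_def Jf_commute)
    with assms(4) show False by simp
  qed
  then show ?thesis using bar_minus_dvec by (metis imageI)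
qed

text \<open>By \<open>reach_from_edges\<close> only edge directions matter. On an edge the form is
  given by \<open>Jf_line\<close>, and the cases are whether its linear coefficient
  \<open>Jf d c \<eta>\<close> vanishes.\<close>

lemma superpotential_cone:
  assumes dpos: "\<forall>i. d i > 0" and sp: "is_superpotential d W A C F"
    and CH: "C \<subseteq> {x. csum x = h}"
    and c: "c \<in> C" "c extreme_point_of (convex hull C)" "Jf d c c = 0"
    and x: "x \<in> C" "x \<noteq> c"
  shows "\<exists>s>0. c + s *\<^sub>R (x - c) \<in> convex hull (bar d ` W)"
proof (rule reach_from_edges[OF _ c(2) convex_convex_hull _ x])
  show fin: "finite C" using sp by (simp add: is_superpotential_def)
  fix \<eta> x\<^sub>0 and s\<^sub>0 :: real
  assume \<eta>: "\<eta> \<noteq> 0" and x0: "x\<^sub>0 \<in> C" "s\<^sub>0 > 0" "x\<^sub>0 = c + s\<^sub>0 *\<^sub>R \<eta>"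
    and face: "\<And>x y \<tau>. x \<in> C \<Longrightarrow> y \<in> C \<Longrightarrow> x + y = 2 *\<^sub>R c + \<tau> *\<^sub>R \<eta> \<Longrightarrow> \<exists>s\<ge>0. x = c + s *\<^sub>R \<eta>"
  let ?S = "{s. 0 < s \<and> c + s *\<^sub>R \<eta> \<in> C}"
  have "inj (\<lambda>s. c + s *\<^sub>R \<eta>)" using \<eta> by (auto intro: injI)
  then have "finite ((\<lambda>s. c + s *\<^sub>R \<eta>) -` C)" using fin by (rule finite_vimageI[rotated])
  then have finS: "finite ?S" by (rule rev_finite_subset) auto
  have neS: "?S \<noteq> {}" using x0 by auto
  have both: "\<exists>s t. 0 \<le> s \<and> 0 \<le> t \<and> x = c + s *\<^sub>R \<eta> \<and> y = c + t *\<^sub>R \<eta> \<and> s + t = \<tau>"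
    if xy: "x \<in> C" "y \<in> C" "x + y = 2 *\<^sub>R c + \<tau> *\<^sub>R \<eta>" for x y \<tau>
  proof -
    have "y + x = 2 *\<^sub>R c + \<tau> *\<^sub>R \<eta>" using xy(3) by (simp add: add.commute)
    with face[OF xy] face[OF xy(2,1)]
    obtain s t where st: "0 \<le> s" "x = c + s *\<^sub>R \<eta>" "0 \<le> t" "y = c + t *\<^sub>R \<eta>"
      by blast
    with xy(3) have "(s + t) *\<^sub>R \<eta> = \<tau> *\<^sub>R \<eta>" by (simp add: scaleR_2 algebra_simps)
    with \<eta> st show ?thesis by auto
  qed
  show "\<exists>s>0. c + s *\<^sub>R \<eta> \<in> convex hull (bar d ` W)"
  proof (cases "Jf d c \<eta> = 0")
    case False
    \<comment> \<open>The nearest point: paired with \<open>c\<close> it gives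
      \<open>s * Jf d c \<eta>\<close>, which is nonzero, and no other pair has the same
      sum.\<close>
    define s where "s = Min ?S"
    have s: "0 < s" "c + s *\<^sub>R \<eta> \<in> C" using Min_in[OF finS neS] by (auto simp: s_def)
    have min: "s \<le> t" if "0 < t" "c + t *\<^sub>R \<eta> \<in> C" for t using Min_le[OF finS] that by (simp add: s_def)
    have "(1/2) *\<^sub>R (c + (c + s *\<^sub>R \<eta>)) \<in> bar d ` W"
    proof (rule superpotential_unique_sum[OF sp c(1) s(2)])
      show "Jf d c (c + s *\<^sub>R \<eta>) \<noteq> 0"
        using False c(3) s(1) by (simp add: Jf_add_right Jf_scaleR_right)
      fix x' y' assume xy: "x' \<in> C" "y' \<in> C" "x' + y' = c + (c + s *\<^sub>R \<eta>)"
      then have "x' + y' = 2 *\<^sub>R c + s *\<^sub>R \<eta>" by (simp add: scaleR_2)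
      from both[OF xy(1,2) this] obtain u v
        where "0 \<le> u" "0 \<le> v" "x' = c + u *\<^sub>R \<eta>" "y' = c + v *\<^sub>R \<eta>" "u + v = s" by blast
      with min[of u] min[of v] xy show "x' = c \<or> x' = c + s *\<^sub>R \<eta>"
        by (cases "u = 0") force+
    qed
    moreover have "(1/2) *\<^sub>R (c + (c + s *\<^sub>R \<eta>)) = c + (s / 2) *\<^sub>R \<eta>"
      by (simp add: scaleR_add_right flip: scaleR_add_left)
    ultimately show ?thesis using s(1) by (intro exI[of _ "s / 2"]) (auto intro: hull_inc)
  next
    case True
    \<comment> \<open>The far end: without a linear term its square is
      \<open>s * s * Jf d \<eta> \<eta> < 0\<close>, and no other pair has twice the far end as its
      sum.\<close>
    define s where "s = Max ?S"
    have s: "0 < s" "c + s *\<^sub>R \<eta> \<in> C" using Max_in[OF finS neS] by (auto simp: s_def)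
    have max: "t \<le> s" if "0 \<le> t" "c + t *\<^sub>R \<eta> \<in> C" for t
      using Max_ge[OF finS, of t] that s(1) by (cases "t = 0") (auto simp: s_def)
    have "csum (c + s\<^sub>0 *\<^sub>R \<eta>) = csum c" using CH c(1) x0(1) unfolding x0(3) by (metis (mono_tags) mem_Collect_eq subsetD)
    then have "csum \<eta> = 0" using x0(2) by simp
    then have neg: "Jf d \<eta> \<eta> < 0" using Jf_neg_definite[OF dpos] \<eta> by blast
    have "(1/2) *\<^sub>R ((c + s *\<^sub>R \<eta>) + (c + s *\<^sub>R \<eta>)) \<in> bar d ` W"
    proof (rule superpotential_unique_sum[OF sp s(2) s(2)])
      show "Jf d (c + s *\<^sub>R \<eta>) (c + s *\<^sub>R \<eta>) \<noteq> 0"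
        using neg True s(1) by (simp add: Jf_line[OF c(3)])
      fix x' y' assume xy: "x' \<in> C" "y' \<in> C" "x' + y' = (c + s *\<^sub>R \<eta>) + (c + s *\<^sub>R \<eta>)"
      then have "x' + y' = 2 *\<^sub>R c + (s + s) *\<^sub>R \<eta>"
        by (simp only: scaleR_2 scaleR_add_left add.assoc add.left_commute)
      from both[OF xy(1,2) this] obtain u v
        where uv: "0 \<le> u" "0 \<le> v" "x' = c + u *\<^sub>R \<eta>" "y' = c + v *\<^sub>R \<eta>" "u + v = s + s" by blast
      with max[of u] max[of v] xy have "u = s" by auto
      with uv show "x' = c + s *\<^sub>R \<eta> \<or> x' = c + s *\<^sub>R \<eta>" by simp
    qed
    moreover have "(1/2) *\<^sub>R ((c + s *\<^sub>R \<eta>) + (c + s *\<^sub>R \<eta>)) = c + s *\<^sub>R \<eta>"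
      by (simp flip: scaleR_2)
    ultimately show ?thesis using s(1) by (intro exI[of _ s]) (auto intro: hull_inc)
  qed
qed

text \<open>Unless \<open>y\<close> or \<open>z\<close> is \<open>c\<close>, the rays from
  \<open>c\<close> through them meet the projection in points p and q. The sum condition makes
  \<open>x\<close> a mean of p and q with positive weights, and extremality gives p = q =
  \<open>x\<close>.\<close>

lemma projected_vertex_pairs:
  fixes c x \<delta> :: "real^'r::finite"
  assumes x: "x extreme_point_of (projP c a b ` B)" and xs: "x = c + s *\<^sub>R \<delta>"
    and sep: "a \<bullet> c < b" "\<forall>z\<in>B. a \<bullet> z > b"
    and y: "y = c \<or> (\<exists>r>0. c + r *\<^sub>R (y - c) \<in> B)"
    and z: "z = c \<or> (\<exists>r>0. c + r *\<^sub>R (z - c) \<in> B)"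
    and sum: "y + z = 2 *\<^sub>R c + \<tau> *\<^sub>R \<delta>"
  shows "\<exists>t. y = c + t *\<^sub>R \<delta>"
proof -
  from sum have sum': "(y - c) + (z - c) = \<tau> *\<^sub>R \<delta>" by (simp add: scaleR_2 algebra_simps)
  have h: "b - a \<bullet> c > 0" using sep by simp
  have proj: "\<exists>m>0. \<exists>p\<in>projP c a b ` B. u - c = m *\<^sub>R (p - c)"
    if "r > 0" "c + r *\<^sub>R (u - c) \<in> B" for u r
  proof -
    have "a \<bullet> (c + r *\<^sub>R (u - c)) > b" using sep(2) that(2) by blast
    then have "r * (a \<bullet> (u - c)) > b - a \<bullet> c" by (simp add: inner_add_right)
    then have au: "a \<bullet> (u - c) > 0" 
      using h that(1) less_trans zero_less_mult_pos by blast
    have "projP c a b (c + r *\<^sub>R (u - c)) = c + ((b - a \<bullet> c) / (a \<bullet> (u - c))) *\<^sub>R (u - c)"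
      using that(1) by (simp add: projP_def)
    then have "u - c = (a \<bullet> (u - c) / (b - a \<bullet> c)) *\<^sub>R (projP c a b (c + r *\<^sub>R (u - c)) - c)"
      using h au by simp
    then show ?thesis using h au that(2) by (intro exI[of _ "a \<bullet> (u - c) / (b - a \<bullet> c)"]) auto
  qed
  have ap: "a \<bullet> (p - c) = b - a \<bullet> c" if "p \<in> projP c a b ` B" for p
  proof -
    from that obtain q where q: "q \<in> B" "p = projP c a b q" by blast
    then have "a \<bullet> (q - c) > 0" using sep by (simp add: inner_diff_right) (meson order.strict_trans)
    with q(2) show ?thesis by (simp add: projP_def)
  qed
  show ?thesis
  proof (cases "y = c \<or> z = c")
    case True
    then show ?thesis
    proof
      assume "y = c" then show ?thesis by (intro exI[of _ 0]) simp
    next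
      assume "z = c"
      with sum' show ?thesis by (intro exI[of _ \<tau>]) (simp add: algebra_simps)
    qed
  next
    case False
    then obtain m p n q where m: "m > 0" "y - c = m *\<^sub>R (p - c)" "p \<in> projP c a b ` B"
      and n: "n > 0" "z - c = n *\<^sub>R (q - c)" "q \<in> projP c a b ` B"
      using y z proj by meson
    have xc: "x - c = s *\<^sub>R \<delta>" using xs by simp
    have "a \<bullet> (x - c) = b - a \<bullet> c" using x ap by (simp add: extreme_point_of_def)
    then have as: "s * (a \<bullet> \<delta>) = b - a \<bullet> c" unfolding xc by simp
    \<comment> \<open>All projected points have the same height over \<open>c\<close> under
      \<open>a\<close>, so comparing heights determines \<open>\<tau>\<close>.\<close>
    have "a \<bullet> (\<tau> *\<^sub>R \<delta>) = (m + n) * (b - a \<bullet> c)"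
      unfolding sum'[symmetric] m(2) n(2) using ap m(3) n(3) by (simp add: inner_add_right algebra_simps)
    then have "\<tau> * (a \<bullet> \<delta>) = ((m + n) * s) * (a \<bullet> \<delta>)" by (simp flip: as)
    moreover have "a \<bullet> \<delta> \<noteq> 0" using as h by auto
    ultimately have "\<tau> = (m + n) * s" by simp
    then have "(m + n) *\<^sub>R (x - c) = m *\<^sub>R (p - c) + n *\<^sub>R (q - c)"
      unfolding xc using sum' m(2) n(2) by simp
    then have comb: "(m + n) *\<^sub>R x = m *\<^sub>R p + n *\<^sub>R q" by (simp add: algebra_simps)
    have "x \<notin> open_segment p q" using x m(3) n(3) by (auto simp: extreme_point_of_def)
    with open_segment_of_positive[OF m(1) n(1) comb] have eq: "p = q" by blast
    then have "(m + n) *\<^sub>R x = (m + n) *\<^sub>R p" using comb by (simp add: algebra_simps)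
    then have "x = p" using m(1) n(1) by simp
    with m(2) xc have "y - c = (m * s) *\<^sub>R \<delta>" by simp
    then show ?thesis by (intro exI[of _ "m * s"]) (simp add: algebra_simps)
  qed
qed

section \<open>Weight types and the exclusion of a second null end\<close>

lemma csum_type:
  assumes "typeI u \<or> typeII u \<or> typeIII u"
  shows "csum u = -1"
  using assms by (auto simp: typeI_def typeII_def typeIII_def)

text \<open>The diagonal part of \<open>Jf\<close> with the sign reversed; an inner product when all
  \<open>d i\<close> are positive.\<close>

definition Qf :: "('r::finite \<Rightarrow> nat) \<Rightarrow> real^'r \<Rightarrow> real^'r \<Rightarrow> real" where
  "Qf d x y = (\<Sum>i\<in>UNIV. x $ i * y $ i / real (d i))"

lemma Qf_simps:
  "Qf d (x + y) z = Qf d x z + Qf d y z" "Qf d (x - y) z = Qf d x z - Qf d y z" "Qf d (k *\<^sub>R x) z = k * Qf d x z"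
  "Qf d z (x + y) = Qf d z x + Qf d z y" "Qf d z (x - y) = Qf d z x - Qf d z y" "Qf d z (k *\<^sub>R x) = k * Qf d z x"
  by (simp_all add: Qf_def sum.distrib sum_subtractf sum_distrib_left algebra_simps add_divide_distrib diff_divide_distrib)

lemma Qf_commute: "Qf d x y = Qf d y x"
  by (simp add: Qf_def mult.commute)

text \<open>Pairing with \<open>dvec d\<close> under \<open>Qf\<close> yields the coordinate sum, so
  all terms but \<open>Qf d x x\<close> are constants. Thus \<open>bar d x\<close> is null exactly
  when \<open>x\<close> has unit length for \<open>Qf\<close>.\<close>

lemma Jf_bar:
  assumes "\<forall>i. d i > 0" "ndim d \<ge> 2" "csum x = -1"
  shows "Jf d (bar d x) (bar d x) = (1 - Qf d x x) / 4"
proof -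
  have "Jf d (bar d x) (bar d x) = (real (ndim d) - 1) / 4 - Qf d (bar d x) (bar d x)"
    using assms by (simp add: Jf_def bar_def Qf_def field_simps)
  moreover have "Qf d (bar d x) (bar d x) = (Qf d (dvec d) (dvec d) + 2 * Qf d (dvec d) x + Qf d x x) / 4"
    by (simp add: bar_def Qf_simps Qf_commute[of d x "dvec d"] field_simps)
  moreover have "Qf d (dvec d) (dvec d) = real (ndim d)"
    using assms(1) by (simp add: Qf_def dvec_def ndim_def)
  moreover have "Qf d (dvec d) x = csum x"
    using assms(1) by (simp add: Qf_def dvec_def csum_def)
  ultimately show ?thesis using assms(3) by (simp add: field_simps)
qed

lemma non_typeI_coordinates:
  assumes "typeII u \<or> typeIII u" "u $ i \<noteq> 0"
  shows "1 \<le> (u $ i)\<^sup>2" "\<exists>j. j \<noteq> i \<and> u $ j \<noteq> 0"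
proof -
  consider (II) j k l where "j \<noteq> k" "j \<noteq> l" "k \<noteq> l" "u = axis j 1 - axis k 1 - axis l 1"
    | (III) j k where "j \<noteq> k" "u = axis j 1 - 2 *\<^sub>R axis k 1"
    using assms(1) by (auto simp: typeII_def typeIII_def)
  then have "1 \<le> (u $ i)\<^sup>2 \<and> (\<exists>j. j \<noteq> i \<and> u $ j \<noteq> 0)"
  proof cases
    case II
    with assms(2) have "i = j \<or> i = k \<or> i = l" by (auto simp: axis_def split: if_splits)
    with II have "u $ i \<in> {1, -1}" "u $ j \<noteq> 0" "u $ k \<noteq> 0" by (auto simp: axis_def)
    then show ?thesis using II(1) by (cases "i = j") (auto simp: power2_eq_square)
  next
    case III
    with assms(2) have "i = j \<or> i = k" by (auto simp: axis_def split: if_splits)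
    with III have "u $ i \<in> {1, -2}" "u $ j \<noteq> 0" "u $ k \<noteq> 0" by (auto simp: axis_def)
    then show ?thesis using III(1) by (cases "i = j") (auto simp: power2_eq_square)
  qed
  then show "1 \<le> (u $ i)\<^sup>2" "\<exists>j. j \<noteq> i \<and> u $ j \<noteq> 0" by auto
qed

text \<open>Equal norms force disjoint supports, and then \<open>5 / d i = 2\<close> for the index \<open>i\<close> of the type I
  vector.\<close>
lemma mixed_types_impossible:
  assumes dpos: "\<forall>i. d i > 0" and v: "typeI v" and u: "typeII u \<or> typeIII u"
    and eq: "Qf d v v = Qf d u u" "5 * Qf d v v - 3 * Qf d v u = 2"
  shows False
proof -
  from v obtain i where i: "v = - axis i 1" by (auto simp: typeI_def)
  have Qv: "Qf d v x = - (x $ i) / real (d i)" for x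
    by (simp add: Qf_def i axis_def if_distrib[where f = "\<lambda>z. z / _"] if_distrib[where f = "\<lambda>z. z * _"] sum_negf cong: if_cong)
  have Qvv: "Qf d v v = 1 / real (d i)" by (simp add: Qv) (simp add: i axis_def)
  \<comment> \<open>Otherwise coordinate \<open>i\<close> alone would contribute at least
    \<open>1 / d i\<close> to the square of \<open>u\<close>, and a second nonzero coordinate would
    make \<open>u\<close> strictly longer than \<open>v\<close>.\<close>
  have "u $ i = 0"
  proof (rule ccontr)
    assume ui: "u $ i \<noteq> 0"
    obtain j where j: "j \<noteq> i" "u $ j \<noteq> 0" using non_typeI_coordinates(2)[OF u ui] by blast
    have "Qf d u u = u $ i * u $ i / real (d i) + (\<Sum>k\<in>UNIV - {i}. u $ k * u $ k / real (d k))"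
      unfolding Qf_def by (rule sum.remove) auto
    moreover have "(\<Sum>k\<in>UNIV - {i}. u $ k * u $ k / real (d k)) > 0"
      using dpos j by (intro sum_pos2[of _ j]) (auto simp: zero_less_mult_iff linorder_neq_iff)
    moreover have "1 / real (d i) \<le> u $ i * u $ i / real (d i)"
      using non_typeI_coordinates(1)[OF u ui] by (intro divide_right_mono) (auto simp: power2_eq_square)
    ultimately show False using eq(1) Qvv by linarith
  qed
  then have "5 / real (d i) = 2" using eq(2) Qvv by (simp add: Qv)
  then have "real (2 * d i) = real 5" using dpos by (simp add: field_simps split: if_splits)
  then have "2 * d i = 5" by (rule of_nat_eq_iff[THEN iffD1])
  then show False by presburger
qed

text \<open>The two ends are mirror images in the midpoint of \<open>v\<close> and \<open>w\<close>.
  By \<open>Jf_bar\<close> both have unit length; subtracting the expanded conditions gives equal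
  lengths of \<open>v\<close> and \<open>w\<close>, and substituting back gives the other premise of
  \<open>mixed_types_impossible\<close>.\<close>

lemma symmetric_null_ends_impossible:
  assumes dpos: "\<forall>i. d i > 0" and n2: "ndim d \<ge> 2"
    and v: "typeI v \<or> typeII v \<or> typeIII v" and w: "typeI w \<or> typeII w \<or> typeIII w"
    and mixed: "typeI v \<noteq> typeI w"
    and ends: "Jf d (bar d ((1/2) *\<^sub>R (3 *\<^sub>R v - w))) (bar d ((1/2) *\<^sub>R (3 *\<^sub>R v - w))) = 0"
      "Jf d (bar d ((1/2) *\<^sub>R (3 *\<^sub>R w - v))) (bar d ((1/2) *\<^sub>R (3 *\<^sub>R w - v))) = 0"
  shows False
proof -
  let ?x = "(1/2) *\<^sub>R (3 *\<^sub>R v - w)" and ?y = "(1/2) *\<^sub>R (3 *\<^sub>R w - v)"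
  have "csum v = -1" "csum w = -1" using v w csum_type by auto
  then have "csum ?x = -1" "csum ?y = -1" by simp_all
  then have "Qf d ?x ?x = 1" "Qf d ?y ?y = 1" using ends Jf_bar[OF dpos n2] by auto
  then have q: "9 * Qf d v v - 6 * Qf d v w + Qf d w w = 4" "9 * Qf d w w - 6 * Qf d v w + Qf d v v = 4"
    by (simp_all add: Qf_simps Qf_commute[of d w v] field_simps)
  then have "Qf d v v = Qf d w w" "5 * Qf d v v - 3 * Qf d v w = 2" by linarith+
  moreover have "typeI v \<and> (typeII w \<or> typeIII w) \<or> typeI w \<and> (typeII v \<or> typeIII v)"
    using v w mixed by blast
  ultimately show False
    using mixed_types_impossible[OF dpos, of v w] mixed_types_impossible[OF dpos, of w v] Qf_commute[of d v w] by auto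
qed

text \<open>A point of \<open>W\<close> beyond one end would put that end inside an open segment of
  the hull, and the face property would force the point into the edge.\<close>

lemma edge_line_points:
  fixes c \<delta> :: "'a::euclidean_space"
  assumes face: "closed_segment (c + \<delta>) (c + \<gamma> *\<^sub>R \<delta>) face_of convex hull W"
    and "W \<inter> open_segment (c + \<delta>) (c + \<gamma> *\<^sub>R \<delta>) = {}" and "1 < \<gamma>" "\<delta> \<noteq> 0"
    and u: "c + \<tau> *\<^sub>R \<delta> \<in> W" and ends: "c + \<delta> \<in> W" "c + \<gamma> *\<^sub>R \<delta> \<in> W"
  shows "\<tau> = 1 \<or> \<tau> = \<gamma>"
proof -
  have between: "c + t *\<^sub>R \<delta> \<in> open_segment (c + r *\<^sub>R \<delta>) (c + s *\<^sub>R \<delta>)" if "r < t" "t < s" for r s t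
  proof (rule open_segment_of_positive[of "s - t" "t - r"])
    show "(s - t + (t - r)) *\<^sub>R (c + t *\<^sub>R \<delta>) = (s - t) *\<^sub>R (c + r *\<^sub>R \<delta>) + (t - r) *\<^sub>R (c + s *\<^sub>R \<delta>)"
      by (simp add: algebra_simps)
  qed (use that \<open>\<delta> \<noteq> 0\<close> in auto)
  have not_outside: "c + t *\<^sub>R \<delta> \<notin> closed_segment (c + \<delta>) (c + \<gamma> *\<^sub>R \<delta>)" if "t < 1 \<or> \<gamma> < t" for t
  proof
    assume "c + t *\<^sub>R \<delta> \<in> closed_segment (c + \<delta>) (c + \<gamma> *\<^sub>R \<delta>)"
    then obtain k where k: "0 \<le> k" "k \<le> 1"
      "c + t *\<^sub>R \<delta> = (1 - k) *\<^sub>R (c + \<delta>) + k *\<^sub>R (c + \<gamma> *\<^sub>R \<delta>)" by (auto simp: in_segment)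
    then have "t *\<^sub>R \<delta> = ((1 - k) + k * \<gamma>) *\<^sub>R \<delta>" by (simp add: algebra_simps)
    then have "t = (1 - k) + k * \<gamma>" using \<open>\<delta> \<noteq> 0\<close> by simp
    moreover have "k * 1 \<le> k * \<gamma>" "(1 - k) * 1 \<le> (1 - k) * \<gamma>"
      using k \<open>1 < \<gamma>\<close> by (intro mult_left_mono; simp)+
    ultimately show False using that by (auto simp: algebra_simps)
  qed
  have hull: "c + \<tau> *\<^sub>R \<delta> \<in> convex hull W" "c + \<delta> \<in> convex hull W" "c + \<gamma> *\<^sub>R \<delta> \<in> convex hull W"
    using u ends by (auto intro: hull_inc)
  have "\<not> \<tau> < 1"
  proof
    assume t: "\<tau> < 1"
    then have "c + \<delta> \<in> open_segment (c + \<tau> *\<^sub>R \<delta>) (c + \<gamma> *\<^sub>R \<delta>)"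
      using between[of \<tau> 1 \<gamma>] \<open>1 < \<gamma>\<close> by simp
    with face_ofD[OF face this] hull not_outside[of \<tau>] t show False by auto
  qed
  moreover have "\<not> \<gamma> < \<tau>"
  proof
    assume t: "\<gamma> < \<tau>"
    then have "c + \<gamma> *\<^sub>R \<delta> \<in> open_segment (c + \<delta>) (c + \<tau> *\<^sub>R \<delta>)"
      using between[of 1 \<gamma> \<tau>] \<open>1 < \<gamma>\<close> by simp
    with face_ofD[OF face this] hull not_outside[of \<tau>] t show False by auto
  qed
  moreover have "\<not> (1 < \<tau> \<and> \<tau> < \<gamma>)"
    using between[of 1 \<tau> \<gamma>] assms(2) u by auto
  ultimately show ?thesis by linarith
qed

section \<open>Restriction of the superpotential equation to the line, and conclusion\<close>

theorem theorem3p11: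
  fixes d :: "'r::finite \<Rightarrow> nat" and W :: "(real^'r) set" and A :: "real^'r \<Rightarrow> real"
    and C :: "(real^'r) set" and F :: "real^'r \<Rightarrow> real"
    and cb xib v w a :: "real^'r" and b :: real
  assumes r2: "CARD('r) \<ge> 2"
    and dpos: "\<forall>i. d i > 0"
    and Wfin: "finite W"
    and Wtypes: "\<forall>u\<in>W. typeI u \<or> typeII u \<or> typeIII u"
    and Anz: "\<forall>u\<in>W. A u \<noteq> 0"
    and Apos: "\<forall>u\<in>W. typeI u \<longrightarrow> A u > 0"
    and Aneg: "\<forall>u\<in>W. \<not> typeI u \<longrightarrow> A u < 0"
    and Wdim: "aff_dim (convex hull W) = int CARD('r) - 1"
    and superpot: "is_superpotential d W A C F"
    and CH: "C \<subseteq> {x. csum x = (real (ndim d) - 1) / 2}"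
    and cbC: "cb \<in> C"
    and cbvert: "cb extreme_point_of (convex hull C)"
    and cbnull: "Jf d cb cb = 0"
    and cbout: "cb \<notin> convex hull (bar d ` W)"
    and Hhyp: "\<not> (\<exists>t. a = t *\<^sub>R 1)"
    and sep1: "a \<bullet> cb < b"
    and sep2: "\<forall>z\<in>convex hull (bar d ` W). a \<bullet> z > b"
    and xivert: "xib extreme_point_of (projP cb a b ` (convex hull (bar d ` W)))"
    and xiJ: "Jf d cb xib \<noteq> 0"
    and vW: "v \<in> W" and wW: "w \<in> W" and vw: "v \<noteq> w"
    and edge: "closed_segment v w face_of convex hull W"
    and coll: "collinear {2 *\<^sub>R cb - dvec d, 2 *\<^sub>R xib - dvec d, v, w}"
    and nearer: "dist (2 *\<^sub>R cb - dvec d) v < dist (2 *\<^sub>R cb - dvec d) w"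
    and nointerior: "W \<inter> open_segment v w = {}"
  shows "(2 *\<^sub>R cb - dvec d = 2 *\<^sub>R v - w \<and>
          C \<inter> affine hull {cb, xib} = {cb, bar d w})
       \<or> (\<exists>c1. 2 *\<^sub>R cb - dvec d = (1/3::real) *\<^sub>R (4 *\<^sub>R v - w) \<and>
          C \<inter> affine hull {cb, xib} = {cb, bar d w, c1} \<and>
          c1 = (1/3::real) *\<^sub>R (2 *\<^sub>R bar d v + bar d w) \<and>
          c1 = (1/2::real) *\<^sub>R (cb + bar d w) \<and>
          Jf d c1 (bar d w) = 0)"
proof -
  define c where "c = 2 *\<^sub>R cb - dvec d"
  define \<delta> where "\<delta> = v - c"
  let ?B = "convex hull (bar d ` W)"
  have cb: "cb = bar d c" by (simp add: c_def bar_def)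
  have bar_line: "bar d (c + t *\<^sub>R \<delta>) = cb + (t / 2) *\<^sub>R \<delta>" for t
    unfolding c_def by (rule bar_on_line)
  have barB: "bar d u \<in> ?B" if "u \<in> W" for u using that by (auto intro: hull_inc)
  have v: "v = c + \<delta>" by (simp add: \<delta>_def)
  have vB: "cb + (1/2) *\<^sub>R \<delta> \<in> ?B" using barB[OF vW] bar_line[of 1] v by simp
  have \<delta>0: "\<delta> \<noteq> 0" using cbout vB by auto
  have cw: "c \<noteq> w" using cbout barB[OF wW] cb by auto
  have n2: "ndim d \<ge> 2"
  proof -
    have "CARD('r) = (\<Sum>i\<in>(UNIV::'r set). 1)" by simp
    also have "\<dots> \<le> ndim d" unfolding ndim_def by (rule sum_mono) (use dpos in \<open>simp add: Suc_leI\<close>)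
    finally show ?thesis using r2 by simp
  qed

  obtain \<gamma> \<sigma> where w_eq: "w = c + \<gamma> *\<^sub>R \<delta>" and \<sigma>: "2 *\<^sub>R xib - dvec d = c + \<sigma> *\<^sub>R \<delta>"
  proof -
    obtain u where u: "\<forall>x\<in>{c, 2 *\<^sub>R xib - dvec d, v, w}. \<forall>y\<in>{c, 2 *\<^sub>R xib - dvec d, v, w}. \<exists>k. x - y = k *\<^sub>R u"
      using coll unfolding collinear_def c_def by blast
    then obtain k where k: "\<delta> = k *\<^sub>R u" unfolding \<delta>_def by blast
    with \<delta>0 have k0: "k \<noteq> 0" by auto
    have "\<exists>t. y = c + t *\<^sub>R \<delta>" if y: "y \<in> {c, 2 *\<^sub>R xib - dvec d, v, w}" for y
    proof -
      obtain l where "y - c = l *\<^sub>R u" using u y by blast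
      then show ?thesis using k k0 by (intro exI[of _ "l / k"]) (simp add: algebra_simps)
    qed
    then show ?thesis using that by blast
  qed
  have \<gamma>1: "1 < \<gamma>"
  proof -
    have "dist c v = norm \<delta>" "dist c w = \<bar>\<gamma>\<bar> * norm \<delta>"
      by (simp_all add: dist_norm v w_eq)
    then have "1 < \<bar>\<gamma>\<bar>" using nearer \<delta>0 unfolding c_def[symmetric] by simp
    \<comment> \<open>Otherwise \<open>cb\<close> would lie between \<open>bar d v\<close> and
      \<open>bar d w\<close>, inside the hull that it avoids.\<close>
    moreover have "\<not> \<gamma> < 0"
    proof
      assume neg: "\<gamma> < 0"
      have "cb \<in> open_segment (cb + (1/2) *\<^sub>R \<delta>) (cb + (\<gamma>/2) *\<^sub>R \<delta>)"
        by (rule open_segment_of_positive[of "- \<gamma>" 1]) (use neg \<delta>0 in \<open>auto simp: algebra_simps\<close>)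
      moreover have "cb + (\<gamma>/2) *\<^sub>R \<delta> \<in> ?B" using barB[OF wW] unfolding w_eq bar_line .
      ultimately show False using cbout vB convex_contains_open_segment[of ?B] by auto
    qed
    ultimately show ?thesis by simp
  qed

  have xib: "xib = cb + (\<sigma> / 2) *\<^sub>R \<delta>"
  proof -
    have "xib = bar d (2 *\<^sub>R xib - dvec d)" by (simp add: bar_def)
    then show ?thesis unfolding \<sigma> bar_line .
  qed
  define P where "P = Jf d cb \<delta>"
  define Q where "Q = Jf d \<delta> \<delta>"
  have "Jf d cb xib = \<sigma> / 2 * P" using cbnull by (simp add: xib P_def Jf_add_right Jf_scaleR_right)
  with xiJ have P0: "P \<noteq> 0" and \<sigma>0: "\<sigma> \<noteq> 0" by auto
  have csum_cb: "csum cb = (real (ndim d) - 1) / 2" using CH cbC by auto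
  have "csum v = -1" using Wtypes vW csum_type by auto
  then have "csum \<delta> = 0" by (simp add: \<delta>_def c_def csum_cb field_simps)
  then have Q0: "Q < 0" unfolding Q_def using Jf_neg_definite[OF dpos] \<delta>0 by blast

  have finC: "finite C" and Fnz: "\<And>x. x \<in> C \<Longrightarrow> F x \<noteq> 0"
    and sup: "\<And>\<xi>. (\<Sum>p\<in>{p. fst p \<in> C \<and> snd p \<in> C \<and> fst p + snd p = \<xi>}. Jf d (fst p) (snd p) * F (fst p) * F (snd p))
          = (if \<xi> - dvec d \<in> W then A (\<xi> - dvec d) else 0)"
    using superpot by (auto simp: is_superpotential_def)
  have cone: "x = cb \<or> (\<exists>s>0. cb + s *\<^sub>R (x - cb) \<in> ?B)" if "x \<in> C" for x
    using superpotential_cone[OF dpos superpot CH cbC cbvert cbnull that] by blast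
  \<comment> \<open>This is what lets the superpotential equation restrict: sums on the line arise
    only from points on the line.\<close>
  have pairs: "\<exists>t. x = cb + t *\<^sub>R \<delta>"
    if "x \<in> C" "y \<in> C" "x + y = 2 *\<^sub>R cb + \<tau> *\<^sub>R \<delta>" for x y \<tau>
    using projected_vertex_pairs[OF xivert xib sep1 sep2 cone[OF that(1)] cone[OF that(2)] that(3)] .

  \<comment> \<open>Although \<open>bar d\<close> halves the parameters of weights, sums of two
    parameters from \<open>T\<close> match them directly, as
    \<open>2 cb + \<tau> \<delta> - d = c + \<tau> \<delta>\<close>.\<close>
  define T where "T = {t. cb + t *\<^sub>R \<delta> \<in> C}"
  define g where "g = (\<lambda>t. F (cb + t *\<^sub>R \<delta>))"
  let ?f = "\<lambda>t. cb + t *\<^sub>R \<delta>"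
  have inj: "inj ?f" using \<delta>0 by (auto intro: injI)
  interpret line_equation T g P Q "A v" "A w" \<gamma> "\<lambda>s t. P * (s + t) + Q * s * t"
  proof
    show "finite T" using finite_vimageI[OF finC inj] by (simp add: T_def vimage_def)
    show "0 \<in> T" using cbC by (simp add: T_def)
    show "P \<noteq> 0" "Q < 0" "1 < \<gamma>" "A v \<noteq> 0" "A w \<noteq> 0" using P0 Q0 \<gamma>1 Anz vW wW by auto
    show "g t \<noteq> 0" if "t \<in> T" for t using Fnz that by (simp add: g_def T_def)
    \<comment> \<open>A negative parameter would, by \<open>cone\<close>, put a point of the hull
      opposite to \<open>bar d v\<close>, with \<open>cb\<close> in between.\<close>
    show "0 \<le> t" if "t \<in> T" for t
    proof (rule ccontr)
      assume neg: "\<not> 0 \<le> t"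
      then have "?f t \<noteq> cb" using \<delta>0 by simp
      with cone[of "?f t"] that obtain s where s: "s > 0" "cb + s *\<^sub>R (t *\<^sub>R \<delta>) \<in> ?B" by (auto simp: T_def)
      have st: "s * t < 0" using s(1) neg by (simp add: mult_pos_neg)
      have "cb \<in> open_segment (cb + (1/2) *\<^sub>R \<delta>) (cb + s *\<^sub>R (t *\<^sub>R \<delta>))"
      proof (rule open_segment_of_positive[of "- 2 * (s * t)" 1])
        show "cb + (1 / 2) *\<^sub>R \<delta> \<noteq> cb + s *\<^sub>R t *\<^sub>R \<delta>"
        proof
          assume "cb + (1 / 2) *\<^sub>R \<delta> = cb + s *\<^sub>R t *\<^sub>R \<delta>"
          then have "(1/2) *\<^sub>R \<delta> = (s * t) *\<^sub>R \<delta>" by simp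
          then have "1/2 = s * t" using \<delta>0 by (metis scaleR_cancel_right)
          with st show False by linarith
        qed
      qed (use st in \<open>auto simp: algebra_simps\<close>)
      with s(2) show False using cbout vB convex_contains_open_segment[of ?B] by auto
    qed
    fix \<tau> :: real
    let ?\<xi> = "2 *\<^sub>R cb + \<tau> *\<^sub>R \<delta>"
    have bij: "bij_betw (\<lambda>p. (?f (fst p), ?f (snd p))) {p. fst p \<in> T \<and> snd p \<in> T \<and> fst p + snd p = \<tau>}
       {p. fst p \<in> C \<and> snd p \<in> C \<and> fst p + snd p = ?\<xi>}"
      unfolding bij_betw_def
    proof (intro conjI equalityI subsetI)
      show "inj_on (\<lambda>p. (?f (fst p), ?f (snd p))) {p. fst p \<in> T \<and> snd p \<in> T \<and> fst p + snd p = \<tau>}"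
        using \<delta>0 by (auto simp: inj_on_def)
    next
      fix p assume "p \<in> (\<lambda>p. (?f (fst p), ?f (snd p))) ` {p. fst p \<in> T \<and> snd p \<in> T \<and> fst p + snd p = \<tau>}"
      then show "p \<in> {p. fst p \<in> C \<and> snd p \<in> C \<and> fst p + snd p = ?\<xi>}"
        by (auto simp: T_def scaleR_2 algebra_simps)
    next
      fix p assume "p \<in> {p. fst p \<in> C \<and> snd p \<in> C \<and> fst p + snd p = ?\<xi>}"
      then have p: "fst p \<in> C" "snd p \<in> C" "fst p + snd p = ?\<xi>" by auto
      obtain s where s: "fst p = ?f s" using pairs[OF p] by blast
      have "snd p = ?\<xi> - fst p" using p(3) by (metis add_diff_cancel_left')
      then have "snd p = ?f (\<tau> - s)" by (simp add: s scaleR_2 algebra_simps)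
      with s p have "p = (\<lambda>p. (?f (fst p), ?f (snd p))) (s, \<tau> - s)" "s \<in> T" "\<tau> - s \<in> T"
        by (auto simp: prod_eq_iff T_def)
      then show "p \<in> (\<lambda>p. (?f (fst p), ?f (snd p))) ` {p. fst p \<in> T \<and> snd p \<in> T \<and> fst p + snd p = \<tau>}"
        by (intro image_eqI[of _ _ "(s, \<tau> - s)"]) auto
    qed
    have \<xi>: "?\<xi> - dvec d = c + \<tau> *\<^sub>R \<delta>" by (simp add: c_def)
    have "c + \<tau> *\<^sub>R \<delta> \<in> W \<longleftrightarrow> \<tau> = 1 \<or> \<tau> = \<gamma>"
      using edge_line_points[of c \<delta> \<gamma> W \<tau>, folded v w_eq] edge nointerior \<gamma>1 \<delta>0 vW wW v w_eq
      by (metis scaleR_one)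
    then have rhs: "(if ?\<xi> - dvec d \<in> W then A (?\<xi> - dvec d) else 0) = (if \<tau> = 1 then A v else if \<tau> = \<gamma> then A w else 0)"
      unfolding \<xi> by (simp add: v w_eq)
    have "(\<Sum>p\<in>{p. fst p \<in> T \<and> snd p \<in> T \<and> fst p + snd p = \<tau>}.
             Jf d (?f (fst p)) (?f (snd p)) * F (?f (fst p)) * F (?f (snd p)))
        = (if \<tau> = 1 then A v else if \<tau> = \<gamma> then A w else 0)"
      using sum.reindex_bij_betw[OF bij, of "\<lambda>p. Jf d (fst p) (snd p) * F (fst p) * F (snd p)"]
        sup[of ?\<xi>] rhs by simp
    then show "(\<Sum>p\<in>{p. fst p \<in> T \<and> snd p \<in> T \<and> fst p + snd p = \<tau>}.
             (P * (fst p + snd p) + Q * fst p * snd p) * g (fst p) * g (snd p))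
        = (if \<tau> = 1 then A v else if \<tau> = \<gamma> then A w else 0)"
      by (simp add: Jf_line[OF cbnull] P_def Q_def g_def)
  qed simp

  have "affine hull {cb, xib} = range ?f"
  proof -
    have "range ?f \<subseteq> range (\<lambda>t. cb + t *\<^sub>R (xib - cb))"
    proof clarify
      fix t
      have "?f t = cb + (2 * t / \<sigma>) *\<^sub>R (xib - cb)" using \<sigma>0 by (simp add: xib)
      then show "?f t \<in> range (\<lambda>t. cb + t *\<^sub>R (xib - cb))" by blast
    qed
    moreover have "range (\<lambda>t. cb + t *\<^sub>R (xib - cb)) \<subseteq> range ?f" by (auto simp: xib)
    ultimately show ?thesis unfolding affine_hull_2_alt by blast
  qed
  then have C_line: "C \<inter> affine hull {cb, xib} = ?f ` T" by (auto simp: T_def)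
  have w_bar: "bar d w = ?f (\<gamma> / 2)" using bar_line[of \<gamma>] by (simp add: w_eq)
  have v_bar: "bar d v = ?f (1 / 2)" using bar_line[of 1] v by simp
  from classification show ?thesis
  proof (elim disjE conjE)
    assume T: "T = {0, 1}" and \<gamma>2: "\<gamma> = 2"
    have "c = 2 *\<^sub>R v - w" by (simp add: v w_eq \<gamma>2 scaleR_2)
    then show ?thesis unfolding C_line w_bar T \<gamma>2 c_def by simp
  next
    assume T: "T = {0, 1, 2}" and \<gamma>4: "\<gamma> = 4" and J: "3 * P + 2 * Q = 0"
    have "c = (1/3) *\<^sub>R (4 *\<^sub>R v - w)"
      unfolding v w_eq \<gamma>4 by (simp add: vec_eq_iff)
    moreover have "?f 1 = (1/3) *\<^sub>R (2 *\<^sub>R bar d v + bar d w)"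
      unfolding v_bar w_bar \<gamma>4 by (simp add: vec_eq_iff)
    moreover have "?f 1 = (1/2) *\<^sub>R (cb + bar d w)"
      unfolding w_bar \<gamma>4 by (simp add: vec_eq_iff)
    moreover have "Jf d (?f 1) (bar d w) = 0"
      unfolding w_bar \<gamma>4 Jf_line[OF cbnull] using J by (simp add: P_def Q_def)
    moreover have "C \<inter> affine hull {cb, xib} = {cb, bar d w, ?f 1}"
      unfolding C_line w_bar T \<gamma>4 by auto
    ultimately show ?thesis unfolding c_def[symmetric] by blast
  next
    assume T: "T = {0, 1, 2}" and \<gamma>3: "\<gamma> = 3" and PQ: "P + Q = 0" and AB: "A v * A w < 0"
    \<comment> \<open>The second point has image \<open>cb + 2 \<delta>\<close> under
      \<open>bar d\<close>, the far end of the spectrum, where the form is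
      \<open>4 * (P + Q) = 0\<close>.\<close>
    have "(1/2) *\<^sub>R (3 *\<^sub>R v - w) = c + 0 *\<^sub>R \<delta>" "(1/2) *\<^sub>R (3 *\<^sub>R w - v) = c + 4 *\<^sub>R \<delta>"
      unfolding v w_eq \<gamma>3 by (simp_all add: vec_eq_iff)
    then have null: "Jf d (bar d ((1/2) *\<^sub>R (3 *\<^sub>R v - w))) (bar d ((1/2) *\<^sub>R (3 *\<^sub>R v - w))) = 0"
      "Jf d (bar d ((1/2) *\<^sub>R (3 *\<^sub>R w - v))) (bar d ((1/2) *\<^sub>R (3 *\<^sub>R w - v))) = 0"
      using PQ cbnull by (simp_all only: bar_line Jf_line[OF cbnull]) (simp_all add: P_def Q_def)
    have "typeI v \<noteq> typeI w"
      using AB Apos Aneg vW wW by (metis mult_neg_neg mult_pos_pos order_less_asym)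
    then have False
      using symmetric_null_ends_impossible[OF dpos n2 _ _ _ null] Wtypes vW wW by blast
    then show ?thesis ..
  qed
qed

end
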